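(* Let $(\mathcal{G},\Sigma)$ be a twisted étale groupoid with associated Fell line bundle $L$, and let $S$ be the inverse semigroup of all bisections $s$ of $\mathcal{G}$ for which the restriction $L_s$ of $L$ to $s$ is a topologically trivial line bundle. For a choice $\{u_s\}_{s\in S}$ of continuous unitary sections $u_s$ of $L_s$ with $u_e=1_e$ for $e\in E(S)$, let $(\mathcal{C}_0(\mathcal{G}^{(0)}),S,\beta,\omega)$ be the twisted action associated to $(\mathcal{G},\Sigma)$ and $\{u_s\}$. Then the cocycles $\omega(s,t)$ can be chosen (i.e. $\{u_s\}_{s\in S}$ can be chosen) to satisfy Sieben's condition $$\omega(s,t)=1_{st}\quad\text{whenever } s\in S \text{ or } t\in S \text{ is an idempotent}$$ if and only if the twist $\Sigma$ is topologically trivial (that is, $\Sigma\cong\mathbb{T}\times\mathcal{G}$ as circle bundles) or, equivalently, if the Fell line bundle $L$ is topologically trivial (that is, $L\cong\mathbb{C}\times\mathcal{G}$ as complex line bundles).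
   Context: An étale groupoid $\mathcal{G}$ is a topological groupoid, not necessarily Hausdorff, with locally compact Hausdorff unit space $\mathcal{G}^{(0)}$ and whose source and range maps $\mathrm{d},\mathrm{r}$ are local homeomorphisms. A bisection is an open set $s\subseteq\mathcal{G}$ on which $\mathrm{d},\mathrm{r}$ are homeomorphisms onto their images; bisections form an inverse semigroup under $st=\{\alpha\beta:\alpha\in s,\beta\in t,\mathrm{d}(\alpha)=\mathrm{r}(\beta)\}$, $s^*=\{\alpha^{-1}:\alpha\in s\}$; its idempotents are the open subsets of $\mathcal{G}^{(0)}$. $E(S)$ denotes the idempotents of $S$. A twist over $\mathcal{G}$ is a topological groupoid $\Sigma$ in a central groupoid extension $\mathbb{T}\times\mathcal{G}^{(0)}\hookrightarrow\Sigma\twoheadrightarrow\mathcal{G}$ making $\Sigma$ a (locally trivial) principal $\mathbb{T}$-bundle over $\mathcal{G}$. The associated Fell line bundle is $L=(\Sigma\times\mathbb{C})/\mathbb{T}$ over $\mathcal{G}$, with $[z\sigma,\lambda]=[\sigma,z\lambda]$, $[\sigma,\lambda][\tau,\mu]=[\sigma\tau,\lambda\mu]$, $[\sigma,\lambda]^*=[\sigma^{-1},\overline{\lambda}]$, $\|[\sigma,\lambda]\|=|\lambda|$. Over $\mathcal{G}^{(0)}$ it is canonically trivial, so continuous sections of $L$ over an open $e\subseteq\mathcal{G}^{(0)}$ are identified with functions on $e$; $1_e$ is the constant function $1$. A section is unitary if it has norm one at each point. For bounded continuous sections $\xi$ of $L_s$ and $\eta$ of $L_t$, put $(\xi\cdot\eta)(\alpha\beta)=\xi(\alpha)\eta(\beta)$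 for $\alpha\in s,\beta\in t$ composable (a section of $L_{st}$) and $\xi^*(\gamma)=\xi(\gamma^{-1})^*$ (a section of $L_{s^*}$). The twisted action of $S$ on $\mathcal{C}_0(\mathcal{G}^{(0)})$ associated to $(\mathcal{G},\Sigma)$ and $\{u_s\}_{s\in S}$ is: $\mathcal{D}_s=\mathcal{C}_0(ss^* )$; $\beta_s:\mathcal{C}_0(s^*s)\to\mathcal{C}_0(ss^* )$, $\beta_s(a)=u_s\cdot a\cdot u_s^*$; and $\omega(s,t)=u_s\cdot u_t\cdot u_{st}^*$, a continuous $\mathbb{T}$-valued function on $stt^*s^*$, i.e. a unitary multiplier of $\mathcal{D}_{st}$. $1_{st}$ is the unit of $\mathcal{M}(\mathcal{D}_{st})$ (the constant function $1$ on $stt^*s^*$). *)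

theory Defs
  imports "HOL-Analysis.Analysis"
begin

section \<open>Topological and etale groupoids\<close>

text \<open>The carrier of a groupoid is the underlying set of its topology, and units are arrows.
  Composability is \<open>d x = r y\<close>; the operations are unconstrained elsewhere.\<close>

record 'a tgroupoid =
  gtop :: "'a topology"
  gd :: "'a \<Rightarrow> 'a"
  gr :: "'a \<Rightarrow> 'a"
  gmul :: "'a \<Rightarrow> 'a \<Rightarrow> 'a"
  ginv :: "'a \<Rightarrow> 'a"

definition arrows :: "'a tgroupoid \<Rightarrow> 'a set" where
  "arrows G = topspace (gtop G)"

definition units :: "'a tgroupoid \<Rightarrow> 'a set" where
  "units G = gd G ` arrows G"

definition unit_space :: "'a tgroupoid \<Rightarrow> 'a topology" where
  "unit_space G = subtopology (gtop G) (units G)"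

definition composable :: "'a tgroupoid \<Rightarrow> ('a \<times> 'a) set" where
  "composable G = {(x, y). x \<in> arrows G \<and> y \<in> arrows G \<and> gd G x = gr G y}"

definition groupoid :: "'a tgroupoid \<Rightarrow> bool" where
  "groupoid G \<longleftrightarrow>
    (\<forall>x\<in>arrows G. gd G x \<in> arrows G \<and> gr G x \<in> arrows G
       \<and> gd G (gd G x) = gd G x \<and> gr G (gd G x) = gd G x
       \<and> gd G (gr G x) = gr G x \<and> gr G (gr G x) = gr G x
       \<and> gmul G (gr G x) x = x \<and> gmul G x (gd G x) = x) \<and>
    (\<forall>(x, y)\<in>composable G. gmul G x y \<in> arrows G
       \<and> gd G (gmul G x y) = gd G y \<and> gr G (gmul G x y) = gr G x) \<and>
    (\<forall>x y z. (x, y) \<in> composable G \<and> (y, z) \<in> composable G \<longrightarrow>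
       gmul G (gmul G x y) z = gmul G x (gmul G y z)) \<and>
    (\<forall>x\<in>arrows G. ginv G x \<in> arrows G
       \<and> gd G (ginv G x) = gr G x \<and> gr G (ginv G x) = gd G x
       \<and> gmul G x (ginv G x) = gr G x \<and> gmul G (ginv G x) x = gd G x)"

definition topological_groupoid :: "'a tgroupoid \<Rightarrow> bool" where
  "topological_groupoid G \<longleftrightarrow>
    groupoid G \<and>
    continuous_map (gtop G) (unit_space G) (gd G) \<and>
    continuous_map (gtop G) (unit_space G) (gr G) \<and>
    continuous_map (subtopology (prod_topology (gtop G) (gtop G)) (composable G)) (gtop G)
      (\<lambda>(x, y). gmul G x y) \<and>
    continuous_map (gtop G) (gtop G) (ginv G)"

definition local_homeomorphism :: "'a topology \<Rightarrow> 'b topology \<Rightarrow> ('a \<Rightarrow> 'b) \<Rightarrow> bool" where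
  "local_homeomorphism X Y f \<longleftrightarrow>
    (\<forall>x\<in>topspace X. \<exists>U. openin X U \<and> x \<in> U \<and> openin Y (f ` U) \<and>
       homeomorphic_map (subtopology X U) (subtopology Y (f ` U)) f)"

definition etale_groupoid :: "'a tgroupoid \<Rightarrow> bool" where
  "etale_groupoid G \<longleftrightarrow>
    topological_groupoid G \<and>
    locally_compact_space (unit_space G) \<and> Hausdorff_space (unit_space G) \<and>
    local_homeomorphism (gtop G) (unit_space G) (gd G) \<and>
    local_homeomorphism (gtop G) (unit_space G) (gr G)"

section \<open>Bisections\<close>

definition bisection :: "'a tgroupoid \<Rightarrow> 'a set \<Rightarrow> bool" where
  "bisection G s \<longleftrightarrow>
    openin (gtop G) s \<and>
    homeomorphic_map (subtopology (gtop G) s) (subtopology (unit_space G) (gd G ` s)) (gd G) \<and>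
    homeomorphic_map (subtopology (gtop G) s) (subtopology (unit_space G) (gr G ` s)) (gr G)"

definition bmul :: "'a tgroupoid \<Rightarrow> 'a set \<Rightarrow> 'a set \<Rightarrow> 'a set" where
  "bmul G s t = {gmul G \<alpha> \<beta> |\<alpha> \<beta>. \<alpha> \<in> s \<and> \<beta> \<in> t \<and> gd G \<alpha> = gr G \<beta>}"

definition bstar :: "'a tgroupoid \<Rightarrow> 'a set \<Rightarrow> 'a set" where
  "bstar G s = ginv G ` s"

section \<open>Twists\<close>

abbreviation circle :: "complex set" where
  "circle \<equiv> sphere 0 1"

text \<open>The bundle of groups \<open>\<T> \<times> G\<^sup>(\<^sup>0\<^sup>)\<close>, whose units are the pairs \<open>(1, x)\<close>.\<close>

definition circle_groupoid :: "'a tgroupoid \<Rightarrow> (complex \<times> 'a) tgroupoid" where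
  "circle_groupoid G =
    \<lparr> gtop = prod_topology (top_of_set circle) (unit_space G),
      gd = (\<lambda>(z, x). (1, x)),
      gr = (\<lambda>(z, x). (1, x)),
      gmul = (\<lambda>(z, x) (w, y). (z * w, x)),
      ginv = (\<lambda>(z, x). (inverse z, x)) \<rparr>"

definition groupoid_hom :: "'a tgroupoid \<Rightarrow> 'b tgroupoid \<Rightarrow> ('a \<Rightarrow> 'b) \<Rightarrow> bool" where
  "groupoid_hom G H f \<longleftrightarrow>
    (\<forall>x\<in>arrows G. f x \<in> arrows H \<and> gd H (f x) = f (gd G x) \<and> gr H (f x) = f (gr G x)) \<and>
    (\<forall>(x, y)\<in>composable G. f (gmul G x y) = gmul H (f x) (f y))"

text \<open>The data of an extension \<open>\<T> \<times> G\<^sup>(\<^sup>0\<^sup>) \<rightarrow> \<Sigma> \<rightarrow> G\<close>: \<open>G\<close> is the base,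
  \<open>\<Sigma>\<close> is the total groupoid.\<close>

record ('g, 's) twist_data =
  base :: "'g tgroupoid"
  total :: "'s tgroupoid"
  incl :: "complex \<times> 'g \<Rightarrow> 's"
  proj :: "'s \<Rightarrow> 'g"

definition tact :: "('g, 's) twist_data \<Rightarrow> complex \<Rightarrow> 's \<Rightarrow> 's" where
  "tact T z \<sigma> = gmul (total T) (incl T (z, gr (base T) (proj T \<sigma>))) \<sigma>"

definition circle_bundle_trivial_over :: "('g, 's) twist_data \<Rightarrow> 'g set \<Rightarrow> bool" where
  "circle_bundle_trivial_over T U \<longleftrightarrow>
    (\<exists>\<phi>. homeomorphic_map
            (subtopology (gtop (total T)) {\<sigma> \<in> arrows (total T). proj T \<sigma> \<in> U})
            (prod_topology (top_of_set circle) (subtopology (gtop (base T)) U)) \<phi> \<and>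
          (\<forall>\<sigma>\<in>arrows (total T). proj T \<sigma> \<in> U \<longrightarrow>
             snd (\<phi> \<sigma>) = proj T \<sigma> \<and>
             (\<forall>z\<in>circle. \<phi> (tact T z \<sigma>) = (z * fst (\<phi> \<sigma>), snd (\<phi> \<sigma>)))))"

definition is_twist :: "('g, 's) twist_data \<Rightarrow> bool" where
  "is_twist T \<longleftrightarrow>
    topological_groupoid (total T) \<and>
    groupoid_hom (circle_groupoid (base T)) (total T) (incl T) \<and>
    embedding_map (gtop (circle_groupoid (base T))) (gtop (total T)) (incl T) \<and>
    groupoid_hom (total T) (base T) (proj T) \<and>
    continuous_map (gtop (total T)) (gtop (base T)) (proj T) \<and>
    proj T ` arrows (total T) = arrows (base T) \<and>
    (\<forall>(z, x)\<in>arrows (circle_groupoid (base T)). proj T (incl T (z, x)) = x) \<and>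
    {\<sigma> \<in> arrows (total T). proj T \<sigma> \<in> units (base T)} =
      incl T ` arrows (circle_groupoid (base T)) \<and>
    (\<forall>z\<in>circle. \<forall>\<sigma>\<in>arrows (total T).
       gmul (total T) (incl T (z, gr (base T) (proj T \<sigma>))) \<sigma> =
       gmul (total T) \<sigma> (incl T (z, gd (base T) (proj T \<sigma>)))) \<and>
    (\<forall>\<gamma>\<in>arrows (base T). \<exists>U. openin (gtop (base T)) U \<and> \<gamma> \<in> U \<and>
       circle_bundle_trivial_over T U)"

definition twisted_etale_groupoid :: "('g, 's) twist_data \<Rightarrow> bool" where
  "twisted_etale_groupoid T \<longleftrightarrow> etale_groupoid (base T) \<and> is_twist T"

definition twist_topologically_trivial :: "('g, 's) twist_data \<Rightarrow> bool" where
  "twist_topologically_trivial T \<longleftrightarrow> circle_bundle_trivial_over T (arrows (base T))"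

section \<open>The associated Fell line bundle\<close>

text \<open>Points of \<open>L = (\<Sigma> \<times> \<complex>)/\<T>\<close> are equivalence classes, i.e. sets of pairs; the relation
  identifies \<open>(z\<sigma>, d)\<close> with \<open>(\<sigma>, zd)\<close>.\<close>

type_synonym 's lb = "('s \<times> complex) set"

definition lb_rel :: "('g, 's) twist_data \<Rightarrow> (('s \<times> complex) \<times> ('s \<times> complex)) set" where
  "lb_rel T = {((\<sigma>, c), (\<tau>, d)) |\<sigma> c \<tau> d.
     \<sigma> \<in> arrows (total T) \<and> (\<exists>z\<in>circle. \<tau> = tact T z \<sigma> \<and> c = z * d)}"

definition lb_class :: "('g, 's) twist_data \<Rightarrow> 's \<Rightarrow> complex \<Rightarrow> 's lb" where
  "lb_class T \<sigma> c = lb_rel T `` {(\<sigma>, c)}"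

definition lb_carrier :: "('g, 's) twist_data \<Rightarrow> 's lb set" where
  "lb_carrier T = (arrows (total T) \<times> UNIV) // lb_rel T"

definition lb_top :: "('g, 's) twist_data \<Rightarrow> 's lb topology" where
  "lb_top T = topology (\<lambda>U. U \<subseteq> lb_carrier T \<and>
     openin (prod_topology (gtop (total T)) euclidean)
       {(\<sigma>, c). \<sigma> \<in> arrows (total T) \<and> lb_class T \<sigma> c \<in> U})"

lemma openin_lb_top:
  "openin (lb_top T) U \<longleftrightarrow> U \<subseteq> lb_carrier T \<and>
     openin (prod_topology (gtop (total T)) euclidean)
       {(\<sigma>, c). \<sigma> \<in> arrows (total T) \<and> lb_class T \<sigma> c \<in> U}"
proof -
  let ?X = "prod_topology (gtop (total T)) (euclidean :: complex topology)"
  let ?P = "\<lambda>U. {(\<sigma>, c). \<sigma> \<in> arrows (total T) \<and> lb_class T \<sigma> c \<in> U}"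
  have "istopology (\<lambda>U. U \<subseteq> lb_carrier T \<and> openin ?X (?P U))"
    unfolding istopology_def
  proof (intro conjI allI impI)
    fix U V assume U: "U \<subseteq> lb_carrier T \<and> openin ?X (?P U)" and V: "V \<subseteq> lb_carrier T \<and> openin ?X (?P V)"
    have "?P (U \<inter> V) = ?P U \<inter> ?P V" by auto
    with U V show "openin ?X (?P (U \<inter> V))" by (metis (no_types, lifting) openin_Int)
    show "U \<inter> V \<subseteq> lb_carrier T" using U by auto
  next
    fix K assume K: "\<forall>U\<in>K. U \<subseteq> lb_carrier T \<and> openin ?X (?P U)"
    have "?P (\<Union>K) = \<Union>(?P ` K)" by auto
    then show "openin ?X (?P (\<Union>K))" using K by (metis (no_types, lifting) imageE openin_Union)
    show "\<Union>K \<subseteq> lb_carrier T" using K by auto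
  qed
  then show ?thesis unfolding lb_top_def by (simp add: topology_inverse')
qed

lemma topspace_lb_top: "topspace (lb_top T) = lb_carrier T"
proof -
  have "{(\<sigma>, c). \<sigma> \<in> arrows (total T) \<and> lb_class T \<sigma> (c::complex) \<in> lb_carrier T} = arrows (total T) \<times> UNIV"
    by (auto simp: lb_carrier_def lb_class_def quotient_def)
  then have "openin (lb_top T) (lb_carrier T)"
    by (simp add: openin_lb_top openin_prod_Times_iff arrows_def)
  then show ?thesis
    by (metis openin_lb_top openin_subset openin_topspace subset_antisym)
qed

text \<open>Operations on classes are given on representatives: the unions below range over
  representatives of the arguments and are unions of a single class, and the images under
  \<open>the_elem\<close> are singletons, whenever the arguments are points of \<open>L\<close> (composable for
  \<open>lb_mul\<close>, in one fibre for \<open>lb_add\<close>).\<close>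

definition lb_proj :: "('g, 's) twist_data \<Rightarrow> 's lb \<Rightarrow> 'g" where
  "lb_proj T a = the_elem ((\<lambda>(\<sigma>, c). proj T \<sigma>) ` a)"

definition lb_norm :: "'s lb \<Rightarrow> real" where
  "lb_norm a = the_elem ((\<lambda>(\<sigma>, c). cmod c) ` a)"

definition lb_mul :: "('g, 's) twist_data \<Rightarrow> 's lb \<Rightarrow> 's lb \<Rightarrow> 's lb" where
  "lb_mul T a b = (\<Union>(\<sigma>, c)\<in>a. \<Union>(\<tau>, d)\<in>b. lb_class T (gmul (total T) \<sigma> \<tau>) (c * d))"

definition lb_star :: "('g, 's) twist_data \<Rightarrow> 's lb \<Rightarrow> 's lb" where
  "lb_star T a = (\<Union>(\<sigma>, c)\<in>a. lb_class T (ginv (total T) \<sigma>) (cnj c))"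

definition lb_add :: "('g, 's) twist_data \<Rightarrow> 's lb \<Rightarrow> 's lb \<Rightarrow> 's lb" where
  "lb_add T a b = (\<Union>(\<sigma>, c)\<in>a. \<Union>d\<in>{d. (\<sigma>, d) \<in> b}. lb_class T \<sigma> (c + d))"

definition lb_scale :: "('g, 's) twist_data \<Rightarrow> complex \<Rightarrow> 's lb \<Rightarrow> 's lb" where
  "lb_scale T k a = (\<Union>(\<sigma>, c)\<in>a. lb_class T \<sigma> (k * c))"

definition line_bundle_trivial_over :: "('g, 's) twist_data \<Rightarrow> 'g set \<Rightarrow> bool" where
  "line_bundle_trivial_over T U \<longleftrightarrow>
    (\<exists>\<phi>. homeomorphic_map
            (subtopology (lb_top T) {a \<in> lb_carrier T. lb_proj T a \<in> U})
            (prod_topology euclidean (subtopology (gtop (base T)) U)) \<phi> \<and>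
          (\<forall>a\<in>lb_carrier T. lb_proj T a \<in> U \<longrightarrow>
             snd (\<phi> a) = lb_proj T a \<and>
             (\<forall>k. fst (\<phi> (lb_scale T k a)) = k * fst (\<phi> a)) \<and>
             (\<forall>b\<in>lb_carrier T. lb_proj T b = lb_proj T a \<longrightarrow>
                fst (\<phi> (lb_add T a b)) = fst (\<phi> a) + fst (\<phi> b))))"

definition line_bundle_topologically_trivial :: "('g, 's) twist_data \<Rightarrow> bool" where
  "line_bundle_topologically_trivial T \<longleftrightarrow> line_bundle_trivial_over T (arrows (base T))"

section \<open>Sections\<close>

text \<open>A section over \<open>s\<close> is a function on all arrows of which only the values on \<open>s\<close> matter.\<close>

definition continuous_section :: "('g, 's) twist_data \<Rightarrow> 'g set \<Rightarrow> ('g \<Rightarrow> 's lb) \<Rightarrow> bool" where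
  "continuous_section T s \<xi> \<longleftrightarrow>
    continuous_map (subtopology (gtop (base T)) s) (lb_top T) \<xi> \<and>
    (\<forall>\<gamma>\<in>s. lb_proj T (\<xi> \<gamma>) = \<gamma>)"

definition unitary_section :: "'g set \<Rightarrow> ('g \<Rightarrow> 's lb) \<Rightarrow> bool" where
  "unitary_section s \<xi> \<longleftrightarrow> (\<forall>\<gamma>\<in>s. lb_norm (\<xi> \<gamma>) = 1)"

text \<open>Product of a section over \<open>s\<close> with a section over \<open>t\<close>; for bisections the factorization
  \<open>\<gamma> = \<alpha>\<beta>\<close> is unique.\<close>

definition sec_mul ::
  "('g, 's) twist_data \<Rightarrow> 'g set \<Rightarrow> ('g \<Rightarrow> 's lb) \<Rightarrow> 'g set \<Rightarrow> ('g \<Rightarrow> 's lb) \<Rightarrow> 'g \<Rightarrow> 's lb" where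
  "sec_mul T s \<xi> t \<eta> \<gamma> =
    (THE a. \<exists>\<alpha>\<in>s. \<exists>\<beta>\<in>t. gd (base T) \<alpha> = gr (base T) \<beta> \<and> \<gamma> = gmul (base T) \<alpha> \<beta> \<and>
       a = lb_mul T (\<xi> \<alpha>) (\<eta> \<beta>))"

definition sec_star :: "('g, 's) twist_data \<Rightarrow> ('g \<Rightarrow> 's lb) \<Rightarrow> 'g \<Rightarrow> 's lb" where
  "sec_star T \<xi> \<gamma> = lb_star T (\<xi> (ginv (base T) \<gamma>))"

text \<open>The canonical trivialization of \<open>L\<close> over the unit space: the function \<open>f\<close> corresponds to
  the section \<open>x \<mapsto> [(1, x), f x]\<close>, where \<open>(1, x)\<close> is viewed in \<open>\<Sigma>\<close>.\<close>

definition fun_section :: "('g, 's) twist_data \<Rightarrow> ('g \<Rightarrow> complex) \<Rightarrow> 'g \<Rightarrow> 's lb" where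
  "fun_section T f x = lb_class T (incl T (1, x)) (f x)"

definition section_fun :: "('g, 's) twist_data \<Rightarrow> ('g \<Rightarrow> 's lb) \<Rightarrow> 'g \<Rightarrow> complex" where
  "section_fun T \<xi> x = (THE c. \<xi> x = lb_class T (incl T (1, x)) c)"

section \<open>The inverse semigroup and its twisted action\<close>

definition twist_bisections :: "('g, 's) twist_data \<Rightarrow> 'g set set" where
  "twist_bisections T = {s. bisection (base T) s \<and> line_bundle_trivial_over T s}"

definition idempotents :: "'g tgroupoid \<Rightarrow> 'g set set \<Rightarrow> 'g set set" where
  "idempotents G S = {e \<in> S. bmul G e e = e}"

definition section_choice :: "('g, 's) twist_data \<Rightarrow> ('g set \<Rightarrow> 'g \<Rightarrow> 's lb) \<Rightarrow> bool" where
  "section_choice T u \<longleftrightarrow>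
    (\<forall>s\<in>twist_bisections T. continuous_section T s (u s) \<and> unitary_section s (u s)) \<and>
    (\<forall>e\<in>idempotents (base T) (twist_bisections T). \<forall>x\<in>e. u e x = fun_section T (\<lambda>_. 1) x)"

text \<open>\<open>C\<^sub>0(e)\<close> as an ideal of \<open>C\<^sub>0(G\<^sup>(\<^sup>0\<^sup>))\<close>: functions are extended by zero outside \<open>e\<close>.\<close>

definition C0 :: "'g tgroupoid \<Rightarrow> 'g set \<Rightarrow> ('g \<Rightarrow> complex) set" where
  "C0 G e = {f. continuous_map (subtopology (gtop G) e) euclidean f \<and>
     (\<forall>\<epsilon>>0. compactin (subtopology (gtop G) e) {x \<in> e. cmod (f x) \<ge> \<epsilon>}) \<and>
     (\<forall>x. x \<notin> e \<longrightarrow> f x = 0)}"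

text \<open>The data \<open>(A, S, \<beta>, \<omega>)\<close> of a twisted action by bisections on an algebra of functions.
  Multipliers of \<open>C\<^sub>0(e)\<close> are functions on \<open>e\<close>, made \<open>undefined\<close> outside \<open>e\<close>.\<close>

record 'g twisted_action =
  ta_algebra :: "('g \<Rightarrow> complex) set"
  ta_index :: "'g set set"
  ta_ideal :: "'g set \<Rightarrow> ('g \<Rightarrow> complex) set"
  ta_act :: "'g set \<Rightarrow> ('g \<Rightarrow> complex) \<Rightarrow> 'g \<Rightarrow> complex"
  ta_cocycle :: "'g set \<Rightarrow> 'g set \<Rightarrow> 'g \<Rightarrow> complex"

definition assoc_twisted_action ::
  "('g, 's) twist_data \<Rightarrow> ('g set \<Rightarrow> 'g \<Rightarrow> 's lb) \<Rightarrow> 'g twisted_action" where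
  "assoc_twisted_action T u =
    (let G = base T in
     \<lparr> ta_algebra = C0 G (units G),
       ta_index = twist_bisections T,
       ta_ideal = (\<lambda>s. C0 G (bmul G s (bstar G s))),
       ta_act = (\<lambda>s. \<lambda>a\<in>C0 G (bmul G (bstar G s) s). \<lambda>x.
         if x \<in> bmul G s (bstar G s)
         then section_fun T
           (sec_mul T s
              (sec_mul T s (u s) (bmul G (bstar G s) s) (fun_section T a))
              (bstar G s) (sec_star T (u s))) x
         else 0),
       ta_cocycle = (\<lambda>s t. \<lambda>x\<in>bmul G (bmul G s t) (bstar G (bmul G s t)).
         section_fun T
           (sec_mul T (bmul G s t) (sec_mul T s (u s) t (u t))
              (bstar G (bmul G s t)) (sec_star T (u (bmul G s t)))) x) \<rparr>)"

definition multiplier_unit :: "'g set \<Rightarrow> 'g \<Rightarrow> complex" where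
  "multiplier_unit e = (\<lambda>x\<in>e. 1)"

definition sieben_condition :: "'g tgroupoid \<Rightarrow> 'g twisted_action \<Rightarrow> bool" where
  "sieben_condition G A \<longleftrightarrow>
    (\<forall>s\<in>ta_index A. \<forall>t\<in>ta_index A.
       s \<in> idempotents G (ta_index A) \<or> t \<in> idempotents G (ta_index A) \<longrightarrow>
       ta_cocycle A s t = multiplier_unit (bmul G (bmul G s t) (bstar G (bmul G s t))))"

end

theory Submission
  imports Defs
begin

text \<open>
  Everything is reduced to continuous sections \<open>\<sigma>\<close> of the circle bundle \<open>\<Sigma> \<rightarrow> G\<close>. Over an open set
  \<open>U\<close> such a section is the same thing as a trivialization of either bundle: the maps
  \<open>(z, \<gamma>) \<mapsto> z \<sigma>(\<gamma>)\<close> and \<open>(c, \<gamma>) \<mapsto> [\<sigma>(\<gamma>), c]\<close> are trivializations of \<open>\<Sigma>\<close> and \<open>L\<close>, and conversely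
  the constant section \<open>1\<close> of a trivial bundle gives a section of \<open>\<Sigma>\<close>, directly or after dividing a
  nonvanishing section of \<open>L\<close> by its norm (lemma \<open>trivial_iff_circle_section\<close>). For \<open>U = G\<close> this
  already shows that \<open>\<Sigma>\<close> and \<open>L\<close> are trivial simultaneously.

  If \<open>u\<^sub>s(\<alpha>) = [\<sigma>, 1]\<close>, \<open>u\<^sub>t(\<beta>) = [\<tau>, 1]\<close> and \<open>u\<^sub>s\<^sub>t(\<alpha>\<beta>) = [\<rho>, 1]\<close>, then the value of
  \<open>\<omega>(s, t)\<close> at \<open>r(\<alpha>)\<close> is the scalar \<open>z\<close> with \<open>\<sigma>\<tau> = z\<rho>\<close> (lemma \<open>cocycle_eq\<close>).

  Suppose Sieben's condition holds. For an open subset \<open>V\<close> of \<open>t \<in> S\<close>, the set \<open>e = r(V)\<close> is an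
  idempotent with \<open>et = V\<close>, and \<open>\<omega>(e, t) = 1\<close> says that \<open>u\<^sub>t\<close> restricts to \<open>u\<^sub>V\<close> on \<open>V\<close> (lemma
  \<open>sieben_imp_restriction\<close>). Hence \<open>u\<^sub>s\<close> and \<open>u\<^sub>t\<close> both restrict to \<open>u\<^bsub>s \<inter> t\<^esub>\<close>, so they agree on
  overlaps. Since the bisections in \<open>S\<close> cover \<open>G\<close>, the sections \<open>u\<^sub>s\<close> glue to a global one (lemma
  \<open>sieben_imp_circle_section\<close>).

  Conversely, a global section \<open>\<sigma>\<close> may be replaced by \<open>\<gamma> \<mapsto> \<sigma>(r(\<gamma>))\<^sup>-\<^sup>1 \<sigma>(\<gamma>)\<close>, which sends every
  unit of \<open>G\<close> to the corresponding unit of \<open>\<Sigma>\<close>. Then \<open>\<sigma>(\<alpha>)\<sigma>(\<beta>) = \<sigma>(\<alpha>\<beta>)\<close> as soon as \<open>\<alpha>\<close> or \<open>\<beta>\<close> is a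
  unit, so the sections \<open>u\<^sub>s = [\<sigma>, 1]\<close> on \<open>s\<close> satisfy Sieben's condition (lemma
  \<open>circle_section_imp_sieben\<close>).
\<close>

section \<open>Groupoid algebra\<close>

locale algebraic_groupoid =
  fixes G :: "'a tgroupoid"
  assumes groupoid: "groupoid G"
begin

lemma arrow_simps [simp]:
  assumes "x \<in> arrows G"
  shows "gd G x \<in> arrows G" "gr G x \<in> arrows G"
    "gd G (gd G x) = gd G x" "gr G (gd G x) = gd G x"
    "gd G (gr G x) = gr G x" "gr G (gr G x) = gr G x"
    "gmul G (gr G x) x = x" "gmul G x (gd G x) = x"
    "ginv G x \<in> arrows G" "gd G (ginv G x) = gr G x" "gr G (ginv G x) = gd G x"
    "gmul G x (ginv G x) = gr G x" "gmul G (ginv G x) x = gd G x"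
  using groupoid assms unfolding groupoid_def by blast+

lemma mul_simps [simp]:
  assumes "x \<in> arrows G" "y \<in> arrows G" "gd G x = gr G y"
  shows "gmul G x y \<in> arrows G" "gd G (gmul G x y) = gd G y" "gr G (gmul G x y) = gr G x"
  using groupoid assms unfolding groupoid_def composable_def by blast+

lemma mul_assoc:
  assumes "x \<in> arrows G" "y \<in> arrows G" "z \<in> arrows G" "gd G x = gr G y" "gd G y = gr G z"
  shows "gmul G (gmul G x y) z = gmul G x (gmul G y z)"
  using groupoid assms unfolding groupoid_def composable_def by blast

lemma mul_inv_cancel_right:
  assumes "x \<in> arrows G" "y \<in> arrows G" "gd G x = gr G y"
  shows "gmul G (gmul G x y) (ginv G y) = x"
  using assms by (simp add: mul_assoc) (metis arrow_simps(8))

lemma mul_inv_cancel_right':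
  assumes "x \<in> arrows G" "y \<in> arrows G" "gd G x = gd G y"
  shows "gmul G (gmul G x (ginv G y)) y = x"
  using assms by (simp add: mul_assoc) (metis arrow_simps(8))

lemma mul_right_cancel:
  assumes "x \<in> arrows G" "x' \<in> arrows G" "y \<in> arrows G" "gd G x = gr G y" "gd G x' = gr G y"
    and "gmul G x y = gmul G x' y"
  shows "x = x'"
  by (metis assms mul_inv_cancel_right)

lemma inv_unique:
  assumes "x \<in> arrows G" "y \<in> arrows G" "gd G x = gr G y" "gmul G x y = gr G x"
  shows "y = ginv G x"
proof -
  have "y = gmul G (gmul G (ginv G x) x) y"
    using assms by simp
  also have "\<dots> = gmul G (ginv G x) (gr G x)"
    using assms by (subst mul_assoc) auto
  also have "\<dots> = ginv G x"
    using assms(1) by (metis arrow_simps(8,9,10))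
  finally show ?thesis .
qed

lemma inv_inv [simp]: "x \<in> arrows G \<Longrightarrow> ginv G (ginv G x) = x"
  by (rule inv_unique[symmetric]) simp_all

lemma units_subset: "units G \<subseteq> arrows G"
  by (auto simp: units_def)

lemma unit_simps [simp]:
  assumes "x \<in> units G"
  shows "x \<in> arrows G" "gd G x = x" "gr G x = x"
  using assms by (auto simp: units_def)

lemma gd_in_units [simp]: "x \<in> arrows G \<Longrightarrow> gd G x \<in> units G"
  unfolding units_def by (rule imageI)

lemma gr_in_units [simp]: "x \<in> arrows G \<Longrightarrow> gr G x \<in> units G"
  by (metis arrow_simps(2,5) gd_in_units)

lemma inv_unit [simp]: "x \<in> units G \<Longrightarrow> ginv G x = x"
  by (metis arrow_simps(7) inv_unique unit_simps)

lemma topspace_unit_space [simp]: "topspace (unit_space G) = units G"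
  using units_subset by (auto simp: unit_space_def arrows_def)

end

lemma topological_groupoid_imp_groupoid: "topological_groupoid G \<Longrightarrow> algebraic_groupoid G"
  by (simp add: topological_groupoid_def algebraic_groupoid_def)

lemma continuous_map_arrow:
  "continuous_map X (gtop G) f \<Longrightarrow> x \<in> topspace X \<Longrightarrow> f x \<in> arrows G"
  by (auto simp: arrows_def dest: continuous_map_funspace)

lemma continuous_map_gmul:
  assumes "topological_groupoid G"
    and f: "continuous_map X (gtop G) f" and g: "continuous_map X (gtop G) g"
    and comp: "\<And>x. x \<in> topspace X \<Longrightarrow> gd G (f x) = gr G (g x)"
  shows "continuous_map X (gtop G) (\<lambda>x. gmul G (f x) (g x))"
proof -
  have "continuous_map X (subtopology (prod_topology (gtop G) (gtop G)) (composable G))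
          (\<lambda>x. (f x, g x))"
    using continuous_map_funspace[OF f] continuous_map_funspace[OF g] comp
    by (auto simp: continuous_map_in_subtopology composable_def arrows_def
        intro!: continuous_map_pairedI f g)
  moreover have "continuous_map (subtopology (prod_topology (gtop G) (gtop G)) (composable G))
          (gtop G) (\<lambda>(x, y). gmul G x y)"
    using assms(1) by (simp add: topological_groupoid_def)
  ultimately show ?thesis
    by (auto dest: continuous_map_compose simp: o_def)
qed

lemma continuous_map_ginv:
  assumes "topological_groupoid G" and "continuous_map X (gtop G) f"
  shows "continuous_map X (gtop G) (\<lambda>x. ginv G (f x))"
  using assms continuous_map_compose[of X "gtop G" f "gtop G" "ginv G"]
  by (simp add: topological_groupoid_def o_def)

lemma continuous_map_gr:
  assumes "topological_groupoid G" and "continuous_map X (gtop G) f"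
  shows "continuous_map X (unit_space G) (\<lambda>x. gr G (f x))"
  using assms continuous_map_compose[of X "gtop G" f "unit_space G" "gr G"]
  by (simp add: topological_groupoid_def o_def)

section \<open>The circle action on a twist\<close>

lemma circle_iff [simp]: "z \<in> circle \<longleftrightarrow> cmod z = 1"
  by (simp add: dist_norm)

lemma circle_conj:
  assumes "cmod z = 1"
  shows "z * cnj z = 1" "cnj z * z = 1" "z * (cnj z * c) = c" "cnj z * (z * c) = c"
proof -
  show 1: "z * cnj z = 1" using assms by (simp add: complex_norm_square[symmetric])
  then show 2: "cnj z * z = 1" by (simp only: mult.commute)
  show "z * (cnj z * c) = c" "cnj z * (z * c) = c"
    using 1 2 by (simp_all only: mult.assoc[symmetric] mult_1_left)
qed

lemma continuous_map_complex_mult: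
  assumes "continuous_map X euclidean f" "continuous_map X euclidean g"
  shows "continuous_map X euclidean (\<lambda>x. f x * g x :: complex)"
proof -
  have "continuous_map X euclidean (\<lambda>x. (f x, g x))"
    using assms continuous_map_paired[of X euclidean euclidean f g] by simp
  moreover have "continuous_map euclidean euclidean (\<lambda>x :: complex \<times> complex. fst x * snd x)"
    by (auto intro!: continuous_intros)
  ultimately show ?thesis
    using continuous_map_compose[of X euclidean "\<lambda>x. (f x, g x)" euclidean "\<lambda>x. fst x * snd x"]
    by (simp add: o_def)
qed

locale twist =
  fixes T :: "('g, 's) twist_data"
  assumes base_topological: "topological_groupoid (base T)" and is_twist: "is_twist T"
begin

abbreviation "G \<equiv> base T"
abbreviation "H \<equiv> total T"
abbreviation "p \<equiv> proj T"

lemma total_topological: "topological_groupoid H"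
  using is_twist by (simp add: is_twist_def)

sublocale B: algebraic_groupoid "base T"
  by (rule topological_groupoid_imp_groupoid[OF base_topological])

sublocale E: algebraic_groupoid "total T"
  by (rule topological_groupoid_imp_groupoid[OF total_topological])

lemma incl_hom: "groupoid_hom (circle_groupoid G) H (incl T)"
  and incl_embedding: "embedding_map (gtop (circle_groupoid G)) (gtop H) (incl T)"
  and proj_hom: "groupoid_hom H G p"
  and proj_continuous: "continuous_map (gtop H) (gtop G) p"
  and proj_kernel: "{\<sigma> \<in> arrows H. p \<sigma> \<in> units G} = incl T ` arrows (circle_groupoid G)"
  and locally_trivial: "\<And>\<gamma>. \<gamma> \<in> arrows G \<Longrightarrow>
        \<exists>U. openin (gtop G) U \<and> \<gamma> \<in> U \<and> circle_bundle_trivial_over T U"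
  using is_twist unfolding is_twist_def by simp_all

lemma arrows_circle_groupoid: "arrows (circle_groupoid G) = circle \<times> units G"
  by (simp add: arrows_def circle_groupoid_def)

lemma incl_simps [simp]:
  assumes "cmod z = 1" "x \<in> units G"
  shows "incl T (z, x) \<in> arrows H" "gd H (incl T (z, x)) = incl T (1, x)"
    "gr H (incl T (z, x)) = incl T (1, x)" "p (incl T (z, x)) = x"
proof -
  have "(z, x) \<in> arrows (circle_groupoid G)"
    using assms by (simp add: arrows_circle_groupoid)
  then have "incl T (z, x) \<in> arrows H
      \<and> gd H (incl T (z, x)) = incl T (gd (circle_groupoid G) (z, x))
      \<and> gr H (incl T (z, x)) = incl T (gr (circle_groupoid G) (z, x))"
    using incl_hom by (simp add: groupoid_hom_def)
  moreover have "p (incl T (z, x)) = x"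
    using is_twist \<open>(z, x) \<in> _\<close> unfolding is_twist_def by (elim conjE) (drule (1) bspec, simp)
  ultimately show "incl T (z, x) \<in> arrows H" "gd H (incl T (z, x)) = incl T (1, x)"
    "gr H (incl T (z, x)) = incl T (1, x)" "p (incl T (z, x)) = x"
    by (simp_all add: circle_groupoid_def)
qed

lemma incl_mul:
  assumes "cmod z = 1" "cmod w = 1" "x \<in> units G"
  shows "gmul H (incl T (z, x)) (incl T (w, x)) = incl T (z * w, x)"
proof -
  have "((z, x), (w, x)) \<in> composable (circle_groupoid G)"
    using assms unfolding composable_def arrows_circle_groupoid by (simp add: circle_groupoid_def)
  then have "incl T (gmul (circle_groupoid G) (z, x) (w, x))
      = gmul H (incl T (z, x)) (incl T (w, x))"
    using incl_hom by (auto simp: groupoid_hom_def)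
  then show ?thesis by (simp add: circle_groupoid_def)
qed

lemma incl_inject:
  assumes "cmod z = 1" "cmod w = 1" "x \<in> units G" "y \<in> units G" "incl T (z, x) = incl T (w, y)"
  shows "z = w" "x = y"
proof -
  have "inj_on (incl T) (arrows (circle_groupoid G))"
    using incl_embedding unfolding embedding_map_def homeomorphic_eq_everything_map
    by (simp add: arrows_def)
  then have "(z, x) = (w, y)"
    by (rule inj_onD) (use assms in \<open>auto simp: arrows_circle_groupoid\<close>)
  then show "z = w" "x = y" by auto
qed

lemma proj_simps [simp]:
  assumes "\<sigma> \<in> arrows H"
  shows "p \<sigma> \<in> arrows G" "p (gd H \<sigma>) = gd G (p \<sigma>)" "p (gr H \<sigma>) = gr G (p \<sigma>)"
  using proj_hom assms by (auto simp: groupoid_hom_def)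

lemma proj_mul [simp]:
  assumes "\<sigma> \<in> arrows H" "\<tau> \<in> arrows H" "gd H \<sigma> = gr H \<tau>"
  shows "p (gmul H \<sigma> \<tau>) = gmul G (p \<sigma>) (p \<tau>)"
  using proj_hom assms by (auto simp: groupoid_hom_def composable_def)

lemma kernel:
  assumes "\<sigma> \<in> arrows H" "p \<sigma> \<in> units G"
  obtains z where "cmod z = 1" "\<sigma> = incl T (z, p \<sigma>)"
proof -
  have "\<sigma> \<in> incl T ` (circle \<times> units G)"
    using proj_kernel assms unfolding arrows_circle_groupoid by blast
  then obtain z x where *: "cmod z = 1" "x \<in> units G" "\<sigma> = incl T (z, x)"
    by auto
  then show thesis using that by simp
qed

text \<open>The source of an arrow of \<open>\<Sigma>\<close> lies in the kernel \<open>\<T> \<times> G\<^sup>(\<^sup>0\<^sup>)\<close>, and the only pair over a given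
  base point that is its own source is the one with circle coordinate \<open>1\<close>.\<close>

lemma gd_total [simp]:
  assumes "\<sigma> \<in> arrows H" shows "gd H \<sigma> = incl T (1, gd G (p \<sigma>))"
proof -
  obtain z where "cmod z = 1" "gd H \<sigma> = incl T (z, p (gd H \<sigma>))"
    using assms kernel[of "gd H \<sigma>"] by auto
  then show ?thesis
    using assms by (metis E.arrow_simps(3) incl_simps(2) proj_simps(1,2) B.gd_in_units)
qed

lemma gr_total [simp]:
  assumes "\<sigma> \<in> arrows H" shows "gr H \<sigma> = incl T (1, gr G (p \<sigma>))"
  using gd_total[of "gr H \<sigma>"] assms E.arrow_simps(2,5)[OF assms] by simp

text \<open>Composability in \<open>\<Sigma>\<close> is decided in \<open>G\<close>, because \<open>\<Sigma>\<close> and \<open>G\<close> have the same units.\<close>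

lemma composable_total_iff:
  assumes "\<sigma> \<in> arrows H" "\<tau> \<in> arrows H"
  shows "gd H \<sigma> = gr H \<tau> \<longleftrightarrow> gd G (p \<sigma>) = gr G (p \<tau>)"
  using assms incl_inject(2)[of 1 1 "gd G (p \<sigma>)" "gr G (p \<tau>)"] by auto

lemma mul_total [simp]:
  assumes "\<sigma> \<in> arrows H" "\<tau> \<in> arrows H" "gd G (p \<sigma>) = gr G (p \<tau>)"
  shows "gmul H \<sigma> \<tau> \<in> arrows H" "p (gmul H \<sigma> \<tau>) = gmul G (p \<sigma>) (p \<tau>)"
  using assms composable_total_iff by auto

lemma proj_inv [simp]:
  assumes "\<sigma> \<in> arrows H"
  shows "p (ginv H \<sigma>) = ginv G (p \<sigma>)"
proof (rule B.inv_unique)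
  show "gd G (p \<sigma>) = gr G (p (ginv H \<sigma>))"
    using assms by (metis E.arrow_simps(9,11) proj_simps(2,3))
  show "gmul G (p \<sigma>) (p (ginv H \<sigma>)) = gr G (p \<sigma>)"
    using assms by (metis E.arrow_simps(9,11,12) proj_mul proj_simps(3))
qed (use assms in auto)

lemma tact_simps [simp]:
  assumes "cmod z = 1" "\<sigma> \<in> arrows H"
  shows "tact T z \<sigma> \<in> arrows H" "p (tact T z \<sigma>) = p \<sigma>"
  using assms by (auto simp: tact_def)

lemma tact_one [simp]:
  assumes "\<sigma> \<in> arrows H" shows "tact T 1 \<sigma> = \<sigma>"
  using assms by (metis E.arrow_simps(7) gr_total tact_def)

lemma tact_tact:
  assumes "cmod z = 1" "cmod w = 1" "\<sigma> \<in> arrows H"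
  shows "tact T z (tact T w \<sigma>) = tact T (z * w) \<sigma>"
  using assms by (simp add: tact_def E.mul_assoc[symmetric] incl_mul)

lemma tact_mul:
  assumes "cmod z = 1" "\<sigma> \<in> arrows H" "\<tau> \<in> arrows H" "gd G (p \<sigma>) = gr G (p \<tau>)"
  shows "gmul H (tact T z \<sigma>) \<tau> = tact T z (gmul H \<sigma> \<tau>)"
  using assms by (simp add: tact_def E.mul_assoc)

lemma tact_central:
  assumes "cmod z = 1" "\<sigma> \<in> arrows H"
  shows "tact T z \<sigma> = gmul H \<sigma> (incl T (z, gd G (p \<sigma>)))"
  using is_twist assms unfolding is_twist_def tact_def by simp

lemma mul_tact:
  assumes "cmod z = 1" "\<sigma> \<in> arrows H" "\<tau> \<in> arrows H" "gd G (p \<sigma>) = gr G (p \<tau>)"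
  shows "gmul H \<sigma> (tact T z \<tau>) = tact T z (gmul H \<sigma> \<tau>)"
proof -
  have "gmul H \<sigma> (tact T z \<tau>) = gmul H (gmul H \<sigma> (incl T (z, gd G (p \<sigma>)))) \<tau>"
    using assms by (simp add: tact_def E.mul_assoc)
  also have "\<dots> = tact T z (gmul H \<sigma> \<tau>)"
    by (simp only: tact_central[OF assms(1,2), symmetric] tact_mul[OF assms])
  finally show ?thesis .
qed

lemma tact_free:
  assumes "cmod z = 1" "cmod w = 1" "\<sigma> \<in> arrows H" "tact T z \<sigma> = tact T w \<sigma>"
  shows "z = w"
proof -
  have "incl T (z, gr G (p \<sigma>)) = incl T (w, gr G (p \<sigma>))"
    by (rule E.mul_right_cancel[of _ _ \<sigma>]) (use assms in \<open>auto simp: tact_def\<close>)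
  then show ?thesis using assms incl_inject by (metis B.gr_in_units proj_simps(1))
qed

text \<open>The circle acts transitively on the fibres of \<open>\<Sigma> \<rightarrow> G\<close>. The scalar is kept as the circle
  coordinate of \<open>\<tau>\<sigma>\<^sup>-\<^sup>1\<close>, since in this form it depends continuously on \<open>\<sigma>\<close> and \<open>\<tau>\<close>.\<close>

lemma quotient_in_kernel:
  assumes "\<sigma> \<in> arrows H" "\<tau> \<in> arrows H" "p \<sigma> = p \<tau>"
  obtains z where "cmod z = 1" "gmul H \<tau> (ginv H \<sigma>) = incl T (z, gr G (p \<sigma>))" "\<tau> = tact T z \<sigma>"
proof -
  let ?q = "gmul H \<tau> (ginv H \<sigma>)"
  have q: "?q \<in> arrows H" "p ?q = gr G (p \<sigma>)"
    using assms by auto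
  obtain z where z: "cmod z = 1" "?q = incl T (z, gr G (p \<sigma>))"
    using kernel[OF q(1)] q(2) assms by auto
  have "gmul H ?q \<sigma> = \<tau>"
    using assms by (intro E.mul_inv_cancel_right') auto
  then have "\<tau> = tact T z \<sigma>" by (simp add: tact_def z(2))
  then show thesis using that z by blast
qed

lemma tact_inv:
  assumes "cmod z = 1" "\<sigma> \<in> arrows H"
  shows "ginv H (tact T z \<sigma>) = tact T (cnj z) (ginv H \<sigma>)"
proof (rule E.inv_unique[symmetric])
  show "gmul H (tact T z \<sigma>) (tact T (cnj z) (ginv H \<sigma>)) = gr H (tact T z \<sigma>)"
    using assms by (simp add: tact_mul mul_tact tact_tact circle_conj)
qed (use assms in auto)

lemma continuous_map_incl:
  assumes "continuous_map X (top_of_set circle) f" "continuous_map X (unit_space G) g"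
  shows "continuous_map X (gtop H) (\<lambda>x. incl T (f x, g x))"
proof -
  have "continuous_map (gtop (circle_groupoid G)) (gtop H) (incl T)"
    using incl_embedding unfolding embedding_map_def homeomorphic_eq_everything_map
    by (simp add: continuous_map_in_subtopology)
  moreover have "continuous_map X (gtop (circle_groupoid G)) (\<lambda>x. (f x, g x))"
    using assms by (simp add: circle_groupoid_def continuous_map_paired)
  ultimately show ?thesis by (auto dest: continuous_map_compose simp: o_def)
qed

lemma continuous_map_proj:
  assumes "continuous_map X (gtop H) f"
  shows "continuous_map X (gtop G) (\<lambda>x. p (f x))"
  using continuous_map_compose[OF assms proj_continuous] by (simp add: o_def)

lemma continuous_map_tact:
  assumes z: "continuous_map X (top_of_set circle) z" and f: "continuous_map X (gtop H) f"
  shows "continuous_map X (gtop H) (\<lambda>x. tact T (z x) (f x))"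
  unfolding tact_def
proof (rule continuous_map_gmul[OF total_topological _ f])
  show "continuous_map X (gtop H) (\<lambda>x. incl T (z x, gr G (p (f x))))"
    by (intro continuous_map_incl z continuous_map_gr[OF base_topological] continuous_map_proj f)
  show "gd H (incl T (z x, gr G (p (f x)))) = gr H (f x)" if "x \<in> topspace X" for x
    using continuous_map_funspace[OF z] continuous_map_arrow[OF f that] that
    by (auto simp: Pi_iff)
qed

section \<open>Sections of the circle bundle\<close>

definition circle_section :: "'g set \<Rightarrow> ('g \<Rightarrow> 's) \<Rightarrow> bool" where
  "circle_section U \<sigma> \<longleftrightarrow>
    continuous_map (subtopology (gtop G) U) (gtop H) \<sigma> \<and> (\<forall>\<gamma>\<in>U. p (\<sigma> \<gamma>) = \<gamma>)"

lemma topspace_sub_base: "U \<subseteq> arrows G \<Longrightarrow> topspace (subtopology (gtop G) U) = U"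
  by (auto simp: arrows_def)

lemma circle_section_simps:
  assumes "circle_section U \<sigma>" "U \<subseteq> arrows G" "\<gamma> \<in> U"
  shows "\<sigma> \<gamma> \<in> arrows H" "p (\<sigma> \<gamma>) = \<gamma>"
  using assms(1,3) continuous_map_arrow[of "subtopology (gtop G) U" H \<sigma> \<gamma>]
  unfolding circle_section_def topspace_sub_base[OF assms(2)] by simp_all

lemma circle_section_subset:
  "circle_section U \<sigma> \<Longrightarrow> V \<subseteq> U \<Longrightarrow> circle_section V \<sigma>"
  unfolding circle_section_def by (blast intro: continuous_map_from_subtopology_mono)

text \<open>A section is a frame. The coordinate of \<open>\<tau>\<close> in it is the circle component of
  \<open>\<tau> \<sigma>(p(\<tau>))\<^sup>-\<^sup>1\<close>; it is continuous because \<open>\<T> \<times> G\<^sup>(\<^sup>0\<^sup>)\<close> is topologically embedded in \<open>\<Sigma>\<close>.\<close>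

lemma section_coordinate:
  assumes U: "U \<subseteq> arrows G" and \<sigma>: "circle_section U \<sigma>"
  obtains \<zeta> where
    "continuous_map (subtopology (gtop H) {\<tau> \<in> arrows H. p \<tau> \<in> U}) (top_of_set circle) \<zeta>"
    "\<And>\<tau>. \<tau> \<in> arrows H \<Longrightarrow> p \<tau> \<in> U \<Longrightarrow> cmod (\<zeta> \<tau>) = 1 \<and> \<tau> = tact T (\<zeta> \<tau>) (\<sigma> (p \<tau>))"
proof -
  let ?C = "gtop (circle_groupoid G)"
  let ?E = "subtopology (gtop H) {\<tau> \<in> arrows H. p \<tau> \<in> U}"
  have E: "topspace ?E = {\<tau> \<in> arrows H. p \<tau> \<in> U}"
    by (auto simp: arrows_def)
  have C: "topspace ?C = circle \<times> units G"
    using arrows_circle_groupoid by (simp add: arrows_def)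
  obtain g where g: "homeomorphic_maps ?C (subtopology (gtop H) (incl T ` topspace ?C)) (incl T) g"
    using incl_embedding unfolding embedding_map_def homeomorphic_map_maps by blast
  define q where "q \<tau> = gmul H \<tau> (ginv H (\<sigma> (p \<tau>)))" for \<tau>
  have id: "continuous_map ?E (gtop H) (\<lambda>\<tau>. \<tau>)"
    using continuous_map_from_subtopology[OF continuous_map_id] by (simp add: id_def)
  have "continuous_map ?E (subtopology (gtop G) U) p"
    using continuous_map_proj[OF id] E by (auto simp: continuous_map_in_subtopology)
  then have "continuous_map ?E (gtop H) (\<lambda>\<tau>. \<sigma> (p \<tau>))"
    using \<sigma> continuous_map_compose[of ?E "subtopology (gtop G) U" p "gtop H" \<sigma>]
    by (simp add: circle_section_def o_def)
  then have "continuous_map ?E (gtop H) q"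
    unfolding q_def using E circle_section_simps[OF \<sigma> U]
    by (intro continuous_map_gmul[OF total_topological id] continuous_map_ginv[OF total_topological])
      auto
  moreover have coord: "cmod (fst (g (q \<tau>))) = 1 \<and> \<tau> = tact T (fst (g (q \<tau>))) (\<sigma> (p \<tau>))
        \<and> q \<tau> \<in> incl T ` topspace ?C"
    if \<tau>: "\<tau> \<in> arrows H" "p \<tau> \<in> U" for \<tau>
  proof -
    have s: "\<sigma> (p \<tau>) \<in> arrows H" "p (\<sigma> (p \<tau>)) = p \<tau>"
      using circle_section_simps[OF \<sigma> U] \<tau>(2) by auto
    obtain z where z: "cmod z = 1" "q \<tau> = incl T (z, gr G (p (\<sigma> (p \<tau>))))" "\<tau> = tact T z (\<sigma> (p \<tau>))"
      using quotient_in_kernel[OF s(1) \<tau>(1) s(2)] unfolding q_def by blast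
    have mem: "(z, gr G (p (\<sigma> (p \<tau>)))) \<in> topspace ?C"
      unfolding C using z(1) s \<tau> by simp
    then have "g (q \<tau>) = (z, gr G (p (\<sigma> (p \<tau>))))"
      using g unfolding homeomorphic_maps_def z(2) by blast
    then show ?thesis using z mem by auto
  qed
  ultimately have "continuous_map ?E (subtopology (gtop H) (incl T ` topspace ?C)) q"
    using E by (auto simp: continuous_map_in_subtopology)
  then have "continuous_map ?E ?C (g \<circ> q)"
    using g continuous_map_compose[of ?E _ q ?C g] by (simp add: homeomorphic_maps_def)
  then have "continuous_map ?E (top_of_set circle) (\<lambda>\<tau>. fst (g (q \<tau>)))"
    by (simp add: circle_groupoid_def continuous_map_pairwise o_def)
  then show thesis using that coord by blast
qed

lemma circle_section_imp_circle_trivial: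
  assumes U: "U \<subseteq> arrows G" and \<sigma>: "circle_section U \<sigma>"
  shows "circle_bundle_trivial_over T U"
proof -
  let ?E = "subtopology (gtop H) {\<tau> \<in> arrows H. p \<tau> \<in> U}"
  let ?P = "prod_topology (top_of_set circle) (subtopology (gtop G) U)"
  have E: "topspace ?E = {\<tau> \<in> arrows H. p \<tau> \<in> U}"
    by (auto simp: arrows_def)
  have P: "topspace ?P = circle \<times> U"
    using U by (auto simp: arrows_def)
  obtain \<zeta> where \<zeta>: "continuous_map ?E (top_of_set circle) \<zeta>"
    and coord: "\<And>\<tau>. \<tau> \<in> arrows H \<Longrightarrow> p \<tau> \<in> U \<Longrightarrow> cmod (\<zeta> \<tau>) = 1 \<and> \<tau> = tact T (\<zeta> \<tau>) (\<sigma> (p \<tau>))"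
    using section_coordinate[OF U \<sigma>] by blast
  note s = circle_section_simps[OF \<sigma> U]
  have \<zeta>_eq: "\<zeta> (tact T z \<tau>) = z * \<zeta> \<tau>" if "cmod z = 1" "\<tau> \<in> arrows H" "p \<tau> \<in> U" for z \<tau>
  proof (rule tact_free)
    have \<tau>: "cmod (\<zeta> \<tau>) = 1" "\<tau> = tact T (\<zeta> \<tau>) (\<sigma> (p \<tau>))"
      using coord that by auto
    have "tact T (\<zeta> (tact T z \<tau>)) (\<sigma> (p \<tau>)) = tact T z \<tau>"
      using coord[of "tact T z \<tau>"] that by simp
    also have "\<dots> = tact T (z * \<zeta> \<tau>) (\<sigma> (p \<tau>))"
      using tact_tact[OF that(1) \<tau>(1) s(1)[OF that(3)]] \<tau>(2) by simp
    finally show "tact T (\<zeta> (tact T z \<tau>)) (\<sigma> (p \<tau>)) = tact T (z * \<zeta> \<tau>) (\<sigma> (p \<tau>))" .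
    show "cmod (\<zeta> (tact T z \<tau>)) = 1" "cmod (z * \<zeta> \<tau>) = 1"
      using coord[of "tact T z \<tau>"] \<tau>(1) that by (simp_all add: norm_mult)
  qed (use s that in auto)
  have \<zeta>_\<sigma>: "\<zeta> (\<sigma> \<gamma>) = 1" if "\<gamma> \<in> U" for \<gamma>
    using coord[of "\<sigma> \<gamma>"] s[OF that] that by (intro tact_free[of _ _ "\<sigma> \<gamma>"]) auto
  have "homeomorphic_maps ?E ?P (\<lambda>\<tau>. (\<zeta> \<tau>, p \<tau>)) (\<lambda>(z, \<gamma>). tact T z (\<sigma> \<gamma>))"
    unfolding homeomorphic_maps_def
  proof (intro conjI)
    show "continuous_map ?E ?P (\<lambda>\<tau>. (\<zeta> \<tau>, p \<tau>))"
      using continuous_map_from_subtopology[OF proj_continuous] \<zeta> E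
      by (auto simp: continuous_map_paired continuous_map_in_subtopology)
    have "continuous_map ?P (gtop H) (\<lambda>x. \<sigma> (snd x))"
      using continuous_map_compose[OF continuous_map_snd, of "subtopology (gtop G) U" "gtop H" \<sigma>] \<sigma>
      by (simp add: circle_section_def o_def)
    then have "continuous_map ?P (gtop H) (\<lambda>x. tact T (fst x) (\<sigma> (snd x)))"
      by (rule continuous_map_tact[OF continuous_map_fst])
    then show "continuous_map ?P ?E (\<lambda>(z, \<gamma>). tact T z (\<sigma> \<gamma>))"
      using s P by (auto simp: continuous_map_in_subtopology split_beta')
    show "\<forall>x\<in>topspace ?E. (\<lambda>(z, \<gamma>). tact T z (\<sigma> \<gamma>)) (\<zeta> x, p x) = x"
      using coord unfolding E by auto
    show "\<forall>y\<in>topspace ?P. (\<zeta> ((\<lambda>(z, \<gamma>). tact T z (\<sigma> \<gamma>)) y), p ((\<lambda>(z, \<gamma>). tact T z (\<sigma> \<gamma>)) y)) = y"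
      unfolding P using \<zeta>_eq \<zeta>_\<sigma> s by auto
  qed
  then have "homeomorphic_map ?E ?P (\<lambda>\<tau>. (\<zeta> \<tau>, p \<tau>))"
    using homeomorphic_map_maps by blast
  then show ?thesis
    unfolding circle_bundle_trivial_over_def
    by (intro exI[of _ "\<lambda>\<tau>. (\<zeta> \<tau>, p \<tau>)"]) (use \<zeta>_eq in auto)
qed

lemma circle_trivial_imp_circle_section:
  assumes U: "U \<subseteq> arrows G" and triv: "circle_bundle_trivial_over T U"
  obtains \<sigma> where "circle_section U \<sigma>"
proof -
  let ?E = "subtopology (gtop H) {\<tau> \<in> arrows H. p \<tau> \<in> U}"
  let ?P = "prod_topology (top_of_set circle) (subtopology (gtop G) U)"
  obtain \<phi> \<psi> where hom: "homeomorphic_maps ?E ?P \<phi> \<psi>"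
    and snd: "\<And>\<tau>. \<tau> \<in> arrows H \<Longrightarrow> p \<tau> \<in> U \<Longrightarrow> snd (\<phi> \<tau>) = p \<tau>"
    using triv unfolding circle_bundle_trivial_over_def homeomorphic_map_maps by blast
  have "continuous_map (subtopology (gtop G) U) ?P (\<lambda>\<gamma>. (1, \<gamma>))"
    using continuous_map_id[of "subtopology (gtop G) U"] by (auto simp: continuous_map_paired id_def)
  then have c: "continuous_map (subtopology (gtop G) U) ?E (\<lambda>\<gamma>. \<psi> (1, \<gamma>))"
    using hom continuous_map_compose[of _ ?P "\<lambda>\<gamma>. (1, \<gamma>)" ?E \<psi>]
    by (simp add: homeomorphic_maps_def o_def)
  have "p (\<psi> (1, \<gamma>)) = \<gamma>" if "\<gamma> \<in> U" for \<gamma>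
  proof -
    have "\<psi> (1, \<gamma>) \<in> topspace ?E"
      using continuous_map_funspace[OF c] that U by (auto simp: arrows_def)
    then have "snd (\<phi> (\<psi> (1, \<gamma>))) = p (\<psi> (1, \<gamma>))"
      by (intro snd) (auto simp: arrows_def)
    moreover have "\<phi> (\<psi> (1, \<gamma>)) = (1, \<gamma>)"
      using hom that U unfolding homeomorphic_maps_def by (auto simp: arrows_def)
    ultimately show ?thesis by simp
  qed
  then have "circle_section U (\<lambda>\<gamma>. \<psi> (1, \<gamma>))"
    using continuous_map_into_fulltopology[OF c] by (simp add: circle_section_def)
  then show thesis by (rule that)
qed

section \<open>The Fell line bundle\<close>

text \<open>Parametrizing the representatives of a point by the circle turns the unions and images over
  representatives, in terms of which the operations on \<open>L\<close> are defined, into unions and images of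
  constant functions on the circle.\<close>

lemma lb_class_eq:
  assumes "\<sigma> \<in> arrows H"
  shows "lb_class T \<sigma> c = (\<lambda>z. (tact T z \<sigma>, cnj z * c)) ` circle"
proof -
  have key: "c = z * d \<longleftrightarrow> d = cnj z * c" if "cmod z = 1" for z d
    using circle_conj(3,4)[OF that] by metis
  have "(\<tau>, d) \<in> lb_class T \<sigma> c \<longleftrightarrow> (\<exists>z\<in>circle. \<tau> = tact T z \<sigma> \<and> c = z * d)" for \<tau> d
    using assms by (simp add: lb_class_def lb_rel_def)
  then have "(\<tau>, d) \<in> lb_class T \<sigma> c \<longleftrightarrow> (\<exists>z\<in>circle. \<tau> = tact T z \<sigma> \<and> d = cnj z * c)" for \<tau> d
    using key circle_iff by metis
  then show ?thesis by auto
qed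

lemma lb_class_in_carrier [simp]: "\<sigma> \<in> arrows H \<Longrightarrow> lb_class T \<sigma> c \<in> lb_carrier T"
  by (auto simp: lb_carrier_def lb_class_def quotient_def)

lemma lb_carrier_cases:
  assumes "a \<in> lb_carrier T"
  obtains \<sigma> c where "\<sigma> \<in> arrows H" "a = lb_class T \<sigma> c"
  using assms that unfolding lb_carrier_def lb_class_def quotient_def by auto

lemma lb_class_tact:
  assumes "cmod z = 1" "\<sigma> \<in> arrows H"
  shows "lb_class T (tact T z \<sigma>) c = lb_class T \<sigma> (z * c)"
proof -
  have "(tact T w (tact T z \<sigma>), cnj w * c) = (tact T (w * z) \<sigma>, cnj (w * z) * (z * c))"
    if "cmod w = 1" for w
    using assms that by (simp add: tact_tact circle_conj mult.assoc)
  then have "lb_class T (tact T z \<sigma>) c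
      = (\<lambda>w. (tact T (w * z) \<sigma>, cnj (w * z) * (z * c))) ` circle"
    using assms by (auto simp: lb_class_eq image_iff)
  also have "\<dots> = (\<lambda>w. (tact T w \<sigma>, cnj w * (z * c))) ` (\<lambda>w. w * z) ` circle"
    by (simp only: image_image)
  also have "(\<lambda>w. w * z) ` circle = circle"
  proof -
    have "w \<in> (\<lambda>w. w * z) ` circle" if "w \<in> circle" for w
      using that assms
      by (intro image_eqI[of _ _ "w * cnj z"]) (auto simp: norm_mult mult.assoc circle_conj)
    then show ?thesis using assms by (auto simp: norm_mult)
  qed
  finally show ?thesis using assms by (simp add: lb_class_eq)
qed

lemma lb_class_inject:
  assumes "\<sigma> \<in> arrows H" "lb_class T \<sigma> c = lb_class T \<sigma> d"
  shows "c = d"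
proof -
  have "(tact T 1 \<sigma>, cnj 1 * c) \<in> lb_class T \<sigma> c"
    unfolding lb_class_eq[OF assms(1)] by (rule imageI) simp
  then have "(tact T 1 \<sigma>, cnj 1 * c) \<in> lb_class T \<sigma> d"
    unfolding assms(2) .
  then have "(tact T 1 \<sigma>, cnj 1 * c) \<in> (\<lambda>z. (tact T z \<sigma>, cnj z * d)) ` circle"
    unfolding lb_class_eq[OF assms(1)] .
  then obtain z where z: "cmod z = 1" "tact T 1 \<sigma> = tact T z \<sigma>" "cnj 1 * c = cnj z * d"
    by (auto simp del: tact_one)
  then show ?thesis using tact_free[OF _ z(1) assms(1) z(2)] by simp
qed

lemma lb_proj_class [simp]: "\<sigma> \<in> arrows H \<Longrightarrow> lb_proj T (lb_class T \<sigma> c) = p \<sigma>"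
  unfolding lb_proj_def lb_class_eq image_image by (simp add: image_constant_conv)

lemma lb_norm_class [simp]: "\<sigma> \<in> arrows H \<Longrightarrow> lb_norm (lb_class T \<sigma> c) = cmod c"
  unfolding lb_norm_def lb_class_eq image_image by (simp add: norm_mult image_constant_conv)

text \<open>Each fibre is a line: a point of \<open>L\<close> has a coordinate in any frame over its base point.\<close>

lemma lb_class_at:
  assumes "a \<in> lb_carrier T" "\<sigma> \<in> arrows H" "lb_proj T a = p \<sigma>"
  obtains c where "a = lb_class T \<sigma> c"
proof -
  obtain \<tau> c where \<tau>: "\<tau> \<in> arrows H" "a = lb_class T \<tau> c"
    using assms(1) by (rule lb_carrier_cases)
  with assms obtain z where "cmod z = 1" "\<tau> = tact T z \<sigma>"
    using quotient_in_kernel[of \<sigma> \<tau>] by auto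
  then show thesis using that lb_class_tact assms(2) \<tau>(2) by auto
qed

lemma lb_unit_class:
  assumes "a \<in> lb_carrier T" "lb_norm a = 1"
  obtains \<sigma> where "\<sigma> \<in> arrows H" "p \<sigma> = lb_proj T a" "a = lb_class T \<sigma> 1"
proof -
  obtain \<tau> c where \<tau>: "\<tau> \<in> arrows H" "a = lb_class T \<tau> c"
    using assms(1) by (rule lb_carrier_cases)
  with assms(2) have "cmod c = 1" by simp
  with \<tau> show thesis using that[of "tact T c \<tau>"] by (simp add: lb_class_tact)
qed

lemma UN_class_const:
  assumes "\<And>z. z \<in> circle \<Longrightarrow> f z = A" shows "(\<Union>z\<in>circle. f z) = A"
proof -
  have "(1::complex) \<in> circle" by simp
  then show ?thesis using assms by blast
qed

lemma lb_mul_class: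
  assumes "\<sigma> \<in> arrows H" "\<tau> \<in> arrows H" "gd G (p \<sigma>) = gr G (p \<tau>)"
  shows "lb_mul T (lb_class T \<sigma> c) (lb_class T \<tau> d) = lb_class T (gmul H \<sigma> \<tau>) (c * d)"
proof -
  have "lb_class T (gmul H (tact T z \<sigma>) (tact T w \<tau>)) (cnj z * c * (cnj w * d))
      = lb_class T (gmul H \<sigma> \<tau>) (c * d)" if "z \<in> circle" "w \<in> circle" for z w
  proof -
    have "z * (w * (cnj z * c * (cnj w * d))) = (z * (cnj z * c)) * (w * (cnj w * d))"
      by simp
    also have "\<dots> = c * d"
      using that by (simp only: circle_iff circle_conj)
    finally have "z * (w * (cnj z * c * (cnj w * d))) = c * d" .
    moreover have "lb_class T (gmul H (tact T z \<sigma>) (tact T w \<tau>)) (cnj z * c * (cnj w * d))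
        = lb_class T (gmul H \<sigma> \<tau>) (z * (w * (cnj z * c * (cnj w * d))))"
      using that assms by (simp add: tact_mul mul_tact lb_class_tact)
    ultimately show ?thesis by (simp only:)
  qed
  then have "(\<Union>z\<in>circle. \<Union>w\<in>circle.
       lb_class T (gmul H (tact T z \<sigma>) (tact T w \<tau>)) (cnj z * c * (cnj w * d)))
      = lb_class T (gmul H \<sigma> \<tau>) (c * d)"
    by (intro UN_class_const)
  then show ?thesis
    unfolding lb_mul_def lb_class_eq[OF assms(1)] lb_class_eq[OF assms(2)] by simp
qed

lemma lb_star_class:
  assumes "\<sigma> \<in> arrows H"
  shows "lb_star T (lb_class T \<sigma> c) = lb_class T (ginv H \<sigma>) (cnj c)"
proof -
  have "lb_class T (ginv H (tact T z \<sigma>)) (cnj (cnj z * c)) = lb_class T (ginv H \<sigma>) (cnj c)"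
    if "z \<in> circle" for z
    using that assms by (simp add: tact_inv lb_class_tact circle_conj)
  then have "(\<Union>z\<in>circle. lb_class T (ginv H (tact T z \<sigma>)) (cnj (cnj z * c)))
      = lb_class T (ginv H \<sigma>) (cnj c)"
    by (intro UN_class_const)
  then show ?thesis
    unfolding lb_star_def lb_class_eq[OF assms] by simp
qed

lemma lb_scale_class:
  assumes "\<sigma> \<in> arrows H"
  shows "lb_scale T k (lb_class T \<sigma> c) = lb_class T \<sigma> (k * c)"
proof -
  have "lb_class T (tact T z \<sigma>) (k * (cnj z * c)) = lb_class T \<sigma> (k * c)" if "z \<in> circle" for z
  proof -
    have "z * (k * (cnj z * c)) = k * c"
      using circle_conj(3)[of z c] that by (simp only: circle_iff mult.left_commute[of z k])
    moreover have "lb_class T (tact T z \<sigma>) (k * (cnj z * c)) = lb_class T \<sigma> (z * (k * (cnj z * c)))"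
      using that assms by (simp add: lb_class_tact)
    ultimately show ?thesis by (simp only:)
  qed
  then have "(\<Union>z\<in>circle. lb_class T (tact T z \<sigma>) (k * (cnj z * c))) = lb_class T \<sigma> (k * c)"
    by (intro UN_class_const)
  then show ?thesis
    unfolding lb_scale_def lb_class_eq[OF assms] by simp
qed

lemma lb_add_class:
  assumes "\<sigma> \<in> arrows H"
  shows "lb_add T (lb_class T \<sigma> c) (lb_class T \<sigma> d) = lb_class T \<sigma> (c + d)"
proof -
  have "(\<Union>b\<in>{b. (tact T z \<sigma>, b) \<in> lb_class T \<sigma> d}. lb_class T (tact T z \<sigma>) (cnj z * c + b))
      = lb_class T \<sigma> (c + d)" if "z \<in> circle" for z
  proof -
    have "{b. (tact T z \<sigma>, b) \<in> lb_class T \<sigma> d} = {cnj z * d}"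
      unfolding lb_class_eq[OF assms] using that tact_free[OF _ _ assms] by (auto simp: image_iff)
    moreover have "z * (cnj z * c + cnj z * d) = c + d"
      using that by (simp add: distrib_left circle_conj)
    ultimately show ?thesis
      using that assms by (simp add: lb_class_tact)
  qed
  then have "(\<Union>z\<in>circle. \<Union>b\<in>{b. (tact T z \<sigma>, b) \<in> lb_class T \<sigma> d}.
      lb_class T (tact T z \<sigma>) (cnj z * c + b)) = lb_class T \<sigma> (c + d)"
    by (intro UN_class_const)
  then show ?thesis
    unfolding lb_add_def by (subst (1) lb_class_eq[OF assms]) simp
qed

lemma quotient_map_lb_class:
  "quotient_map (prod_topology (gtop H) euclidean) (lb_top T) (\<lambda>(\<sigma>, c). lb_class T \<sigma> c)"
  unfolding quotient_map_def
proof (intro conjI allI impI)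
  let ?X = "prod_topology (gtop H) (euclidean :: complex topology)"
  show "(\<lambda>(\<sigma>, c). lb_class T \<sigma> c) ` topspace ?X = topspace (lb_top T)"
    unfolding topspace_lb_top by (auto simp: arrows_def[symmetric] elim!: lb_carrier_cases)
  fix U assume "U \<subseteq> topspace (lb_top T)"
  moreover have "{x \<in> topspace ?X. (case x of (\<sigma>, c) \<Rightarrow> lb_class T \<sigma> c) \<in> U}
      = {(\<sigma>, c). \<sigma> \<in> arrows H \<and> lb_class T \<sigma> c \<in> U}"
    by (auto simp: arrows_def)
  ultimately show "openin ?X {x \<in> topspace ?X. (case x of (\<sigma>, c) \<Rightarrow> lb_class T \<sigma> c) \<in> U}
      = openin (lb_top T) U"
    unfolding topspace_lb_top by (simp add: openin_lb_top)
qed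

lemma continuous_map_lb_class:
  assumes "continuous_map X (gtop H) f" "continuous_map X euclidean c"
  shows "continuous_map X (lb_top T) (\<lambda>x. lb_class T (f x) (c x))"
proof -
  have "continuous_map X (prod_topology (gtop H) euclidean) (\<lambda>x. (f x, c x))"
    using assms by (simp add: continuous_map_paired)
  from continuous_map_compose[OF this quotient_imp_continuous_map[OF quotient_map_lb_class]]
  show ?thesis by (simp add: o_def)
qed

text \<open>Restricting the quotient map to an open set of \<open>L\<close> keeps it a quotient map, so continuity out
  of open parts of \<open>L\<close> is checked on representatives.\<close>

lemma continuous_map_from_lb:
  assumes A: "openin (lb_top T) A"
    and W: "W = {(\<sigma>, c). \<sigma> \<in> arrows H \<and> lb_class T \<sigma> c \<in> A}"
    and f: "continuous_map (subtopology (prod_topology (gtop H) euclidean) W) Y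
      (\<lambda>(\<sigma>, c). f (lb_class T \<sigma> c))"
  shows "continuous_map (subtopology (lb_top T) A) Y f"
proof -
  have "W = {x \<in> topspace (prod_topology (gtop H) euclidean). (\<lambda>(\<sigma>, c). lb_class T \<sigma> c) x \<in> A}"
    unfolding W by (auto simp: arrows_def)
  then have "quotient_map (subtopology (prod_topology (gtop H) euclidean) W)
      (subtopology (lb_top T) A) (\<lambda>(\<sigma>, c). lb_class T \<sigma> c)"
    using quotient_map_restriction[OF quotient_map_lb_class _ disjI1[OF A]] by metis
  then show ?thesis
    by (rule continuous_compose_quotient_map) (use f in \<open>simp add: o_def split_beta'\<close>)
qed

section \<open>Nonvanishing sections of the line bundle\<close>

text \<open>The polar part of a nonzero point of \<open>L\<close>: such a point is \<open>[\<sigma>, r]\<close> with \<open>r > 0\<close> for exactly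
  one \<open>\<sigma>\<close>.\<close>

definition direction :: "'s lb \<Rightarrow> 's" where
  "direction a = (THE \<sigma>. \<sigma> \<in> arrows H \<and> a = lb_class T \<sigma> (of_real (lb_norm a)))"

lemma direction_class:
  assumes "\<sigma> \<in> arrows H" "c \<noteq> 0"
  shows "direction (lb_class T \<sigma> c) = tact T (sgn c) \<sigma>"
proof -
  have c: "sgn c * of_real (cmod c) = c" and n: "cmod (sgn c) = 1"
    using assms(2) by (simp_all add: sgn_eq norm_divide)
  show ?thesis
    unfolding direction_def lb_norm_class[OF assms(1)]
  proof (rule the_equality)
    show "tact T (sgn c) \<sigma> \<in> arrows H
        \<and> lb_class T \<sigma> c = lb_class T (tact T (sgn c) \<sigma>) (of_real (cmod c))"
      using assms n c by (simp add: lb_class_tact)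
    fix \<tau> assume \<tau>: "\<tau> \<in> arrows H \<and> lb_class T \<sigma> c = lb_class T \<tau> (of_real (cmod c))"
    then have "p \<sigma> = p \<tau>" using assms(1) lb_proj_class by metis
    then obtain z where z: "cmod z = 1" "\<tau> = tact T z \<sigma>"
      using quotient_in_kernel assms(1) \<tau> by blast
    then have "lb_class T \<sigma> c = lb_class T \<sigma> (z * of_real (cmod c))"
      using \<tau> assms(1) by (simp add: lb_class_tact)
    then have "c = z * of_real (cmod c)" by (rule lb_class_inject[OF assms(1)])
    then have "z = sgn c" using assms(2) by (simp add: sgn_eq field_simps)
    then show "\<tau> = tact T (sgn c) \<sigma>" using z by simp
  qed
qed

lemma continuous_map_direction:
  "continuous_map (subtopology (lb_top T) {a \<in> lb_carrier T. lb_norm a \<noteq> 0}) (gtop H) direction"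
proof (rule continuous_map_from_lb)
  let ?A = "{a \<in> lb_carrier T. lb_norm a \<noteq> 0}"
  let ?W = "arrows H \<times> - {0 :: complex}"
  let ?X = "prod_topology (gtop H) (euclidean :: complex topology)"
  show W: "?W = {(\<sigma>, c). \<sigma> \<in> arrows H \<and> lb_class T \<sigma> c \<in> ?A}"
    by auto
  have "open (- {0 :: complex})"
    by (intro open_Compl closed_singleton)
  then have "openin ?X ?W"
    by (simp add: openin_prod_Times_iff arrows_def)
  then show "openin (lb_top T) ?A"
    unfolding openin_lb_top W by blast
  have tW: "topspace (subtopology ?X ?W) = ?W"
    by (auto simp: arrows_def)
  have "continuous_map (subtopology ?X ?W) (top_of_set (- {0})) snd"
    using continuous_map_from_subtopology[OF continuous_map_snd] tW
    by (auto simp: continuous_map_in_subtopology)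
  moreover have "continuous_map (top_of_set (- {0})) (top_of_set circle) (sgn :: complex \<Rightarrow> complex)"
    by (auto simp: continuous_map_in_subtopology norm_sgn intro!: continuous_intros)
  ultimately have "continuous_map (subtopology ?X ?W) (top_of_set circle) (sgn \<circ> snd)"
    by (rule continuous_map_compose)
  then have "continuous_map (subtopology ?X ?W) (top_of_set circle) (\<lambda>x. sgn (snd x))"
    by (simp only: o_def)
  then have "continuous_map (subtopology ?X ?W) (gtop H) (\<lambda>x. tact T (sgn (snd x)) (fst x))"
    by (intro continuous_map_tact continuous_map_from_subtopology[OF continuous_map_fst])
  then show "continuous_map (subtopology ?X ?W) (gtop H) (\<lambda>(\<sigma>, c). direction (lb_class T \<sigma> c))"
  proof (rule continuous_map_eq)
    fix x assume "x \<in> topspace (subtopology ?X ?W)"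
    then have "fst x \<in> arrows H" "snd x \<noteq> 0" unfolding tW by auto
    then show "tact T (sgn (snd x)) (fst x) = (\<lambda>(\<sigma>, c). direction (lb_class T \<sigma> c)) x"
      by (simp add: direction_class split_beta)
  qed
qed

lemma circle_section_direction:
  assumes U: "U \<subseteq> arrows G" and \<xi>: "continuous_section T U \<xi>"
    and nz: "\<And>\<gamma>. \<gamma> \<in> U \<Longrightarrow> lb_norm (\<xi> \<gamma>) \<noteq> 0"
  shows "circle_section U (\<lambda>\<gamma>. direction (\<xi> \<gamma>))"
proof -
  have c: "continuous_map (subtopology (gtop G) U) (lb_top T) \<xi>"
    and proj: "\<And>\<gamma>. \<gamma> \<in> U \<Longrightarrow> lb_proj T (\<xi> \<gamma>) = \<gamma>"
    using \<xi> by (auto simp: continuous_section_def)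
  have car: "\<xi> \<gamma> \<in> lb_carrier T" if "\<gamma> \<in> U" for \<gamma>
    using continuous_map_funspace[OF c] that U by (auto simp: topspace_lb_top arrows_def)
  have "continuous_map (subtopology (gtop G) U)
      (subtopology (lb_top T) {a \<in> lb_carrier T. lb_norm a \<noteq> 0}) \<xi>"
    using c car nz by (auto simp: continuous_map_in_subtopology)
  then have "continuous_map (subtopology (gtop G) U) (gtop H) (\<lambda>\<gamma>. direction (\<xi> \<gamma>))"
    using continuous_map_compose[OF _ continuous_map_direction] by (simp add: o_def)
  moreover have "p (direction (\<xi> \<gamma>)) = \<gamma>" if \<gamma>: "\<gamma> \<in> U" for \<gamma>
  proof -
    obtain \<sigma> c where *: "\<sigma> \<in> arrows H" "\<xi> \<gamma> = lb_class T \<sigma> c"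
      using lb_carrier_cases[OF car[OF \<gamma>]] by blast
    then have "c \<noteq> 0" "p \<sigma> = \<gamma>" using nz[OF \<gamma>] proj[OF \<gamma>] by auto
    then show ?thesis using * by (simp add: direction_class norm_sgn)
  qed
  ultimately show ?thesis by (simp add: circle_section_def)
qed

text \<open>Linearity of the trivialization on fibres is what prevents the section corresponding to the
  constant \<open>1\<close> from meeting the zero section.\<close>

lemma line_trivial_imp_circle_section:
  assumes U: "U \<subseteq> arrows G" and triv: "line_bundle_trivial_over T U"
  obtains \<sigma> where "circle_section U \<sigma>"
proof -
  let ?E = "subtopology (lb_top T) {a \<in> lb_carrier T. lb_proj T a \<in> U}"
  let ?P = "prod_topology (euclidean :: complex topology) (subtopology (gtop G) U)"
  obtain \<phi> \<psi> where hom: "homeomorphic_maps ?E ?P \<phi> \<psi>"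
    and lin: "\<And>a. a \<in> lb_carrier T \<Longrightarrow> lb_proj T a \<in> U \<Longrightarrow> snd (\<phi> a) = lb_proj T a
          \<and> (\<forall>k. fst (\<phi> (lb_scale T k a)) = k * fst (\<phi> a))"
    using triv unfolding line_bundle_trivial_over_def homeomorphic_map_maps by blast
  have "continuous_map (subtopology (gtop G) U) ?P (\<lambda>\<gamma>. (1, \<gamma>))"
    using continuous_map_id[of "subtopology (gtop G) U"] by (auto simp: continuous_map_paired id_def)
  then have c: "continuous_map (subtopology (gtop G) U) ?E (\<lambda>\<gamma>. \<psi> (1, \<gamma>))"
    using hom continuous_map_compose[of _ ?P "\<lambda>\<gamma>. (1, \<gamma>)" ?E \<psi>]
    by (simp add: homeomorphic_maps_def o_def)
  have in_E: "\<psi> (1, \<gamma>) \<in> lb_carrier T" "lb_proj T (\<psi> (1, \<gamma>)) \<in> U"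
    and \<phi>\<psi>: "\<phi> (\<psi> (1, \<gamma>)) = (1, \<gamma>)" if "\<gamma> \<in> U" for \<gamma>
  proof -
    show "\<psi> (1, \<gamma>) \<in> lb_carrier T" "lb_proj T (\<psi> (1, \<gamma>)) \<in> U"
      using continuous_map_funspace[OF c] that U by (auto simp: arrows_def)
    show "\<phi> (\<psi> (1, \<gamma>)) = (1, \<gamma>)"
      using hom that U unfolding homeomorphic_maps_def by (auto simp: arrows_def)
  qed
  have "continuous_section T U (\<lambda>\<gamma>. \<psi> (1, \<gamma>))"
    unfolding continuous_section_def
  proof (intro conjI ballI)
    show "continuous_map (subtopology (gtop G) U) (lb_top T) (\<lambda>\<gamma>. \<psi> (1, \<gamma>))"
      using continuous_map_into_fulltopology[OF c] .
    show "lb_proj T (\<psi> (1, \<gamma>)) = \<gamma>" if "\<gamma> \<in> U" for \<gamma>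
      using lin[OF in_E[OF that]] \<phi>\<psi>[OF that] by simp
  qed
  moreover have "lb_norm (\<psi> (1, \<gamma>)) \<noteq> 0" if \<gamma>: "\<gamma> \<in> U" for \<gamma>
  proof
    assume 0: "lb_norm (\<psi> (1, \<gamma>)) = 0"
    obtain \<tau> c where *: "\<tau> \<in> arrows H" "\<psi> (1, \<gamma>) = lb_class T \<tau> c"
      using lb_carrier_cases[OF in_E(1)[OF \<gamma>]] by blast
    then have "lb_scale T 0 (\<psi> (1, \<gamma>)) = \<psi> (1, \<gamma>)"
      using 0 by (simp add: lb_scale_class)
    then have "fst (\<phi> (\<psi> (1, \<gamma>))) = 0"
      using lin[OF in_E[OF \<gamma>]] by (metis mult_zero_left)
    then show False using \<phi>\<psi>[OF \<gamma>] by simp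
  qed
  ultimately show thesis using that circle_section_direction[OF U] by blast
qed

text \<open>Since \<open>U\<close> is open, the part of \<open>L\<close> over \<open>U\<close> is open, and continuity of the coordinate map can
  be checked on representatives, where it is \<open>(\<tau>, c) \<mapsto> \<zeta>(\<tau>) c\<close> with \<open>\<zeta>\<close> the coordinate of
  \<open>\<Sigma>\<close> in the frame \<open>\<sigma>\<close>.\<close>

lemma circle_section_imp_line_trivial:
  assumes U: "openin (gtop G) U" and \<sigma>: "circle_section U \<sigma>"
  shows "line_bundle_trivial_over T U"
proof -
  let ?A = "{a \<in> lb_carrier T. lb_proj T a \<in> U}"
  let ?E = "subtopology (lb_top T) ?A"
  let ?P = "prod_topology (euclidean :: complex topology) (subtopology (gtop G) U)"
  let ?X = "prod_topology (gtop H) (euclidean :: complex topology)"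
  let ?V = "{\<tau> \<in> arrows H. p \<tau> \<in> U}"
  let ?W = "?V \<times> (UNIV :: complex set)"
  have UG: "U \<subseteq> arrows G"
    using openin_subset[OF U] by (simp add: arrows_def)
  have E: "topspace ?E = ?A"
    by (auto simp: topspace_lb_top)
  have P: "topspace ?P = UNIV \<times> U"
    using UG by (auto simp: arrows_def)
  note s = circle_section_simps[OF \<sigma> UG]
  obtain \<zeta> where \<zeta>: "continuous_map (subtopology (gtop H) ?V) (top_of_set circle) \<zeta>"
    and coord: "\<And>\<tau>. \<tau> \<in> arrows H \<Longrightarrow> p \<tau> \<in> U \<Longrightarrow> cmod (\<zeta> \<tau>) = 1 \<and> \<tau> = tact T (\<zeta> \<tau>) (\<sigma> (p \<tau>))"
    using section_coordinate[OF UG \<sigma>] by blast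
  \<comment> \<open>the coordinate of a point of \<open>L\<close> in the frame \<open>[\<sigma>, 1]\<close>\<close>
  define k where "k a = (THE k. a = lb_class T (\<sigma> (lb_proj T a)) k)" for a
  have k_frame: "k (lb_class T (\<sigma> \<gamma>) c) = c" if "\<gamma> \<in> U" for \<gamma> c
    unfolding k_def using s[OF that] lb_class_inject by (intro the_equality) auto
  have k_class: "k (lb_class T \<tau> c) = \<zeta> \<tau> * c" if "\<tau> \<in> arrows H" "p \<tau> \<in> U" for \<tau> c
  proof -
    have "lb_class T \<tau> c = lb_class T (tact T (\<zeta> \<tau>) (\<sigma> (p \<tau>))) c"
      using coord[OF that] by simp
    also have "\<dots> = lb_class T (\<sigma> (p \<tau>)) (\<zeta> \<tau> * c)"
      using coord[OF that] s(1)[OF that(2)] by (intro lb_class_tact) auto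
    finally show ?thesis using k_frame[OF that(2)] by simp
  qed
  have "homeomorphic_maps ?E ?P (\<lambda>a. (k a, lb_proj T a)) (\<lambda>(c, \<gamma>). lb_class T (\<sigma> \<gamma>) c)"
    unfolding homeomorphic_maps_def
  proof (intro conjI)
    show "continuous_map ?E ?P (\<lambda>a. (k a, lb_proj T a))"
    proof (rule continuous_map_from_lb)
      show W: "?W = {(\<sigma>, c). \<sigma> \<in> arrows H \<and> lb_class T \<sigma> c \<in> ?A}"
        by auto
      have V: "openin (gtop H) ?V"
        using openin_continuous_map_preimage[OF proj_continuous U] by (simp add: arrows_def)
      then have "openin ?X ?W"
        by (simp add: openin_prod_Times_iff)
      then show "openin (lb_top T) ?A"
        unfolding openin_lb_top W by blast
      have tW: "topspace (subtopology ?X ?W) = ?W"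
        by (auto simp: arrows_def)
      have fst: "continuous_map (subtopology ?X ?W) (subtopology (gtop H) ?V) fst"
        using continuous_map_from_subtopology[OF continuous_map_fst] tW
        by (auto simp: continuous_map_in_subtopology)
      have "continuous_map (subtopology ?X ?W) euclidean (\<lambda>x. \<zeta> (fst x))"
        using continuous_map_compose[OF fst \<zeta>]
        by (simp add: o_def continuous_map_in_subtopology)
      then have "continuous_map (subtopology ?X ?W) euclidean (\<lambda>x. \<zeta> (fst x) * snd x)"
        by (intro continuous_map_complex_mult continuous_map_from_subtopology[OF continuous_map_snd])
      moreover have "continuous_map (subtopology ?X ?W) (subtopology (gtop G) U) (\<lambda>x. p (fst x))"
        using continuous_map_proj[OF continuous_map_into_fulltopology[OF fst]] tW
        by (auto simp: continuous_map_in_subtopology)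
      ultimately have "continuous_map (subtopology ?X ?W) ?P (\<lambda>x. (\<zeta> (fst x) * snd x, p (fst x)))"
        by (simp add: continuous_map_paired)
      then show "continuous_map (subtopology ?X ?W) ?P
          (\<lambda>(\<tau>, c). (k (lb_class T \<tau> c), lb_proj T (lb_class T \<tau> c)))"
        by (rule continuous_map_eq) (auto simp: tW k_class)
    qed
    have "continuous_map ?P (gtop H) (\<lambda>x. \<sigma> (snd x))"
      using continuous_map_compose[OF continuous_map_snd, of "subtopology (gtop G) U" "gtop H" \<sigma>] \<sigma>
      by (simp add: circle_section_def o_def)
    then have "continuous_map ?P (lb_top T) (\<lambda>x. lb_class T (\<sigma> (snd x)) (fst x))"
      by (intro continuous_map_lb_class continuous_map_fst)
    moreover have "lb_class T (\<sigma> (snd x)) (fst x) \<in> ?A" if "x \<in> topspace ?P" for x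
      using that s[of "snd x"] unfolding P by auto
    ultimately show "continuous_map ?P ?E (\<lambda>(c, \<gamma>). lb_class T (\<sigma> \<gamma>) c)"
      unfolding split_beta' by (intro continuous_map_into_subtopology Pi_I)
    show "\<forall>x\<in>topspace ?E. (\<lambda>(c, \<gamma>). lb_class T (\<sigma> \<gamma>) c) (k x, lb_proj T x) = x"
    proof
      fix x assume "x \<in> topspace ?E"
      then have x: "x \<in> lb_carrier T" "lb_proj T x \<in> U" unfolding E by auto
      then obtain c where "x = lb_class T (\<sigma> (lb_proj T x)) c"
        using lb_class_at[OF x(1), of "\<sigma> (lb_proj T x)"] s[OF x(2)] by metis
      then show "(\<lambda>(c, \<gamma>). lb_class T (\<sigma> \<gamma>) c) (k x, lb_proj T x) = x"
        using k_frame[OF x(2), of c] by simp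
    qed
    show "\<forall>y\<in>topspace ?P. (k ((\<lambda>(c, \<gamma>). lb_class T (\<sigma> \<gamma>) c) y),
        lb_proj T ((\<lambda>(c, \<gamma>). lb_class T (\<sigma> \<gamma>) c) y)) = y"
      unfolding P using k_frame s by auto
  qed
  then have "homeomorphic_map ?E ?P (\<lambda>a. (k a, lb_proj T a))"
    using homeomorphic_map_maps by blast
  moreover have "snd (k a, lb_proj T a) = lb_proj T a
      \<and> (\<forall>c. fst (k (lb_scale T c a), lb_proj T (lb_scale T c a)) = c * fst (k a, lb_proj T a))
      \<and> (\<forall>b\<in>lb_carrier T. lb_proj T b = lb_proj T a \<longrightarrow>
          fst (k (lb_add T a b), lb_proj T (lb_add T a b)) = fst (k a, lb_proj T a) + fst (k b, lb_proj T b))"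
    if a: "a \<in> lb_carrier T" "lb_proj T a \<in> U" for a
  proof -
    have sa: "\<sigma> (lb_proj T a) \<in> arrows H" "p (\<sigma> (lb_proj T a)) = lb_proj T a"
      using s[OF a(2)] by auto
    have frame: "\<exists>d. b = lb_class T (\<sigma> (lb_proj T a)) d"
      if "b \<in> lb_carrier T" "lb_proj T b = lb_proj T a" for b
      using lb_class_at[OF that(1) sa(1)] sa(2) that(2) by metis
    obtain d where d: "a = lb_class T (\<sigma> (lb_proj T a)) d"
      using frame a(1) by blast
    have "k (lb_scale T c a) = c * k a" for c
      by (subst (1 2) d) (simp add: lb_scale_class[OF sa(1)] k_frame[OF a(2)])
    moreover have "k (lb_add T a b) = k a + k b"
      if b: "b \<in> lb_carrier T" "lb_proj T b = lb_proj T a" for b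
    proof -
      obtain e where e: "b = lb_class T (\<sigma> (lb_proj T a)) e"
        using frame[OF b] by blast
      have "lb_add T a b = lb_class T (\<sigma> (lb_proj T a)) (d + e)"
        using lb_add_class[OF sa(1), of d e] d e by simp
      then show ?thesis
        using k_frame[OF a(2)] d e by metis
    qed
    ultimately show ?thesis by simp
  qed
  ultimately show ?thesis
    unfolding line_bundle_trivial_over_def by (intro exI[of _ "\<lambda>a. (k a, lb_proj T a)"]) blast
qed

lemma trivial_iff_circle_section:
  assumes "openin (gtop G) U"
  shows "circle_bundle_trivial_over T U \<longleftrightarrow> (\<exists>\<sigma>. circle_section U \<sigma>)"
    and "line_bundle_trivial_over T U \<longleftrightarrow> (\<exists>\<sigma>. circle_section U \<sigma>)"
proof -
  have U: "U \<subseteq> arrows G"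
    using openin_subset[OF assms] by (simp add: arrows_def)
  show "circle_bundle_trivial_over T U \<longleftrightarrow> (\<exists>\<sigma>. circle_section U \<sigma>)"
    using circle_section_imp_circle_trivial[OF U] circle_trivial_imp_circle_section[OF U] by metis
  show "line_bundle_trivial_over T U \<longleftrightarrow> (\<exists>\<sigma>. circle_section U \<sigma>)"
    using circle_section_imp_line_trivial[OF assms] line_trivial_imp_circle_section[OF U] by metis
qed

end

section \<open>Bisections of etale groupoids\<close>

lemma local_homeomorphism_imp_open_map:
  assumes "local_homeomorphism X Y f"
  shows "open_map X Y f"
  unfolding open_map_def
proof (intro allI impI)
  fix W assume W: "openin X W"
  show "openin Y (f ` W)"
  proof (subst openin_subopen, rule ballI)
    fix y assume "y \<in> f ` W"
    then obtain x where x: "x \<in> W" "y = f x" by blast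
    with W have "x \<in> topspace X" using openin_subset by blast
    then obtain U where U: "openin X U" "x \<in> U" "openin Y (f ` U)"
      "homeomorphic_map (subtopology X U) (subtopology Y (f ` U)) f"
      using assms unfolding local_homeomorphism_def by blast
    have "openin (subtopology Y (f ` U)) (f ` (W \<inter> U))"
      using homeomorphic_imp_open_map[OF U(4)] openin_subtopology_Int[OF W, of U]
      unfolding open_map_def by blast
    then have "openin Y (f ` (W \<inter> U))" using openin_trans_full U(3) by blast
    then show "\<exists>V. openin Y V \<and> y \<in> V \<and> V \<subseteq> f ` W"
      using x U(2) by (intro exI[of _ "f ` (W \<inter> U)"]) auto
  qed
qed

lemma homeomorphic_map_restrict:
  assumes hom: "homeomorphic_map (subtopology X U) (subtopology Y (f ` U)) f"
    and U: "U \<subseteq> topspace X" and V: "V \<subseteq> U"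
  shows "homeomorphic_map (subtopology X V) (subtopology Y (f ` V)) f"
proof -
  have "f ` (topspace X \<inter> U) = topspace Y \<inter> f ` U"
    using homeomorphic_imp_surjective_map[OF hom] by simp
  then have "f ` U \<subseteq> topspace Y"
    using U by (metis Int_absorb1 Int_lower1)
  then have "f ` (topspace (subtopology X U) \<inter> V) = topspace (subtopology Y (f ` U)) \<inter> f ` V"
    using U V by auto
  from homeomorphic_map_subtopologies[OF hom this] show ?thesis
    using V by (simp add: subtopology_subtopology Int_absorb1 image_mono)
qed

lemma bisection_subset:
  assumes "bisection G s" "openin (gtop G) V" "V \<subseteq> s"
  shows "bisection G V"
  using assms(1) openin_subset[of "gtop G" s] assms(2,3) unfolding bisection_def
  by (simp add: homeomorphic_map_restrict[of _ s _ _ V])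

lemma bisection_simps:
  assumes "bisection G s"
  shows "openin (gtop G) s" "s \<subseteq> arrows G" "inj_on (gd G) s" "inj_on (gr G) s"
proof -
  show 1: "openin (gtop G) s" using assms by (simp add: bisection_def)
  show 2: "s \<subseteq> arrows G" using openin_subset[OF 1] by (simp add: arrows_def)
  then have "topspace (subtopology (gtop G) s) = s" by (auto simp: arrows_def)
  then show "inj_on (gd G) s" "inj_on (gr G) s"
    using assms homeomorphic_imp_injective_map unfolding bisection_def by metis+
qed

locale etale =
  fixes G :: "'a tgroupoid"
  assumes etale: "etale_groupoid G"
begin

lemma topological: "topological_groupoid G"
  and gd_local_homeomorphism: "local_homeomorphism (gtop G) (unit_space G) (gd G)"
  and gr_local_homeomorphism: "local_homeomorphism (gtop G) (unit_space G) (gr G)"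
  using etale by (simp_all add: etale_groupoid_def)

sublocale algebraic_groupoid G
  by (rule topological_groupoid_imp_groupoid[OF topological])

text \<open>Near a unit \<open>x\<close> the source map is injective, and it identifies \<open>\<gamma>\<close> with the unit
  \<open>d(\<gamma>)\<close>, which is also near \<open>x\<close>.\<close>

lemma openin_units: "openin (gtop G) (units G)"
proof (subst openin_subopen, rule ballI)
  fix x assume x: "x \<in> units G"
  then have "x \<in> topspace (gtop G)" using units_subset by (auto simp: arrows_def)
  then obtain U where U: "openin (gtop G) U" "x \<in> U"
    and hom: "homeomorphic_map (subtopology (gtop G) U) (subtopology (unit_space G) (gd G ` U)) (gd G)"
    using gd_local_homeomorphism unfolding local_homeomorphism_def by blast
  have UG: "U \<subseteq> arrows G" using openin_subset[OF U(1)] by (simp add: arrows_def)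
  have inj: "inj_on (gd G) U"
    using homeomorphic_imp_injective_map[OF hom] UG by (simp add: arrows_def Int_absorb1)
  let ?V = "U \<inter> {\<gamma> \<in> topspace (gtop G). gd G \<gamma> \<in> units G \<inter> U}"
  have "openin (unit_space G) (units G \<inter> U)"
    unfolding unit_space_def by (rule openin_subtopology_Int2[OF U(1)])
  then have "openin (gtop G) ?V"
    using topological U(1) unfolding topological_groupoid_def
    by (blast intro: openin_continuous_map_preimage)
  moreover have "x \<in> ?V"
    using x U UG by (auto simp: arrows_def)
  moreover have "?V \<subseteq> units G"
  proof
    fix \<gamma> assume \<gamma>: "\<gamma> \<in> ?V"
    then have "gd G (gd G \<gamma>) = gd G \<gamma>" using UG by auto
    then have "gd G \<gamma> = \<gamma>" using inj_onD[OF inj] \<gamma> by blast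
    then show "\<gamma> \<in> units G" using \<gamma> by auto
  qed
  ultimately show "\<exists>V. openin (gtop G) V \<and> x \<in> V \<and> V \<subseteq> units G" by blast
qed

lemma bisection_units:
  assumes "openin (gtop G) e" "e \<subseteq> units G"
  shows "bisection G e"
proof -
  have e: "subtopology (unit_space G) e = subtopology (gtop G) e"
    unfolding unit_space_def subtopology_subtopology using assms(2) by (simp add: Int_absorb1)
  have unit: "gd G x = x" "gr G x = x" if "x \<in> e" for x
    using that assms(2) by auto
  have im: "gd G ` e = e" "gr G ` e = e"
    using unit by (simp_all cong: image_cong)
  have id: "homeomorphic_map (subtopology (gtop G) e) (subtopology (gtop G) e) id"
    by simp
  show ?thesis
    unfolding bisection_def im e
    by (intro conjI assms(1) homeomorphic_map_eq[OF id]) (auto simp: unit)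
qed

text \<open>If \<open>\<gamma> = \<alpha>\<beta>\<close> within a bisection, then \<open>\<alpha> = \<beta> = \<gamma>\<close>, as \<open>\<gamma>\<close> shares its range with \<open>\<alpha>\<close> and
  its source with \<open>\<beta>\<close>; and \<open>\<gamma>\<gamma> = \<gamma>\<close> makes \<open>\<gamma>\<close> a unit.\<close>

lemma idempotent_bisection_subset_units:
  assumes "bisection G e" "bmul G e e = e"
  shows "e \<subseteq> units G"
proof
  fix \<gamma> assume \<gamma>: "\<gamma> \<in> e"
  note b = bisection_simps[OF assms(1)]
  obtain \<alpha> \<beta> where *: "\<alpha> \<in> e" "\<beta> \<in> e" "gd G \<alpha> = gr G \<beta>" "\<gamma> = gmul G \<alpha> \<beta>"
    using \<gamma> assms(2) unfolding bmul_def by blast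
  have arr: "\<alpha> \<in> arrows G" "\<beta> \<in> arrows G" "\<gamma> \<in> arrows G"
    using * \<gamma> b(2) by auto
  have "gd G \<beta> = gd G \<gamma>" "gr G \<alpha> = gr G \<gamma>" using * arr by simp_all
  then have "\<beta> = \<gamma>" "\<alpha> = \<gamma>"
    using inj_onD[OF b(3) _ *(2) \<gamma>] inj_onD[OF b(4) _ *(1) \<gamma>] by simp_all
  then have "gd G \<gamma> = gr G \<gamma>" "gmul G \<gamma> \<gamma> = \<gamma>" using *(3) *(4)[symmetric] by simp_all
  then have "gr G \<gamma> = \<gamma>"
    using mul_inv_cancel_right[of \<gamma> \<gamma>] arr(3) by simp
  then show "\<gamma> \<in> units G" using arr(3) gr_in_units[of \<gamma>] by simp
qed

lemma bmul_units_left: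
  assumes "e \<subseteq> units G" "t \<subseteq> arrows G"
  shows "bmul G e t = {\<gamma> \<in> t. gr G \<gamma> \<in> e}"
proof (intro set_eqI iffI)
  fix \<gamma> assume "\<gamma> \<in> bmul G e t"
  then obtain x \<beta> where "x \<in> e" "\<beta> \<in> t" "gd G x = gr G \<beta>" "\<gamma> = gmul G x \<beta>"
    unfolding bmul_def by blast
  moreover from this have "x = gr G \<beta>" using assms(1) by auto
  ultimately show "\<gamma> \<in> {\<gamma> \<in> t. gr G \<gamma> \<in> e}" using assms(2) by auto
next
  fix \<gamma> assume \<gamma>: "\<gamma> \<in> {\<gamma> \<in> t. gr G \<gamma> \<in> e}"
  then have "\<gamma> \<in> arrows G" using assms(2) by blast
  then have "\<gamma> = gmul G (gr G \<gamma>) \<gamma>" "gd G (gr G \<gamma>) = gr G \<gamma>" by simp_all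
  with \<gamma> show "\<gamma> \<in> bmul G e t" unfolding bmul_def by blast
qed

lemma bmul_subset: "s \<subseteq> arrows G \<Longrightarrow> t \<subseteq> arrows G \<Longrightarrow> bmul G s t \<subseteq> arrows G"
  by (auto simp: bmul_def intro!: mul_simps(1))

lemma inj_on_gr_bmul:
  assumes "s \<subseteq> arrows G" "t \<subseteq> arrows G" "inj_on (gr G) s" "inj_on (gr G) t"
  shows "inj_on (gr G) (bmul G s t)"
proof (rule inj_onI)
  fix x y assume "x \<in> bmul G s t" "y \<in> bmul G s t" and eq: "gr G x = gr G y"
  then obtain \<alpha> \<beta> \<alpha>' \<beta>' where *: "\<alpha> \<in> s" "\<beta> \<in> t" "gd G \<alpha> = gr G \<beta>" "x = gmul G \<alpha> \<beta>"
    "\<alpha>' \<in> s" "\<beta>' \<in> t" "gd G \<alpha>' = gr G \<beta>'" "y = gmul G \<alpha>' \<beta>'"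
    unfolding bmul_def by blast
  then have arr: "\<alpha> \<in> arrows G" "\<beta> \<in> arrows G" "\<alpha>' \<in> arrows G" "\<beta>' \<in> arrows G"
    using assms by auto
  have "gr G \<alpha> = gr G \<alpha>'" using eq * arr by simp
  then have 1: "\<alpha> = \<alpha>'" by (rule inj_onD[OF assms(3) _ *(1) *(5)])
  then have "gr G \<beta> = gr G \<beta>'" using *(3,7) by simp
  then have "\<beta> = \<beta>'" by (rule inj_onD[OF assms(4) _ *(2) *(6)])
  with 1 show "x = y" using * by simp
qed

lemma inj_on_gd_bmul:
  assumes "s \<subseteq> arrows G" "t \<subseteq> arrows G" "inj_on (gd G) s" "inj_on (gd G) t"
  shows "inj_on (gd G) (bmul G s t)"
proof (rule inj_onI)
  fix x y assume "x \<in> bmul G s t" "y \<in> bmul G s t" and eq: "gd G x = gd G y"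
  then obtain \<alpha> \<beta> \<alpha>' \<beta>' where *: "\<alpha> \<in> s" "\<beta> \<in> t" "gd G \<alpha> = gr G \<beta>" "x = gmul G \<alpha> \<beta>"
    "\<alpha>' \<in> s" "\<beta>' \<in> t" "gd G \<alpha>' = gr G \<beta>'" "y = gmul G \<alpha>' \<beta>'"
    unfolding bmul_def by blast
  then have arr: "\<alpha> \<in> arrows G" "\<beta> \<in> arrows G" "\<alpha>' \<in> arrows G" "\<beta>' \<in> arrows G"
    using assms by auto
  have "gd G \<beta> = gd G \<beta>'" using eq * arr by simp
  then have 1: "\<beta> = \<beta>'" by (rule inj_onD[OF assms(4) _ *(2) *(6)])
  then have "gd G \<alpha> = gd G \<alpha>'" using *(3,7) by simp
  then have "\<alpha> = \<alpha>'" by (rule inj_onD[OF assms(3) _ *(1) *(5)])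
  with 1 show "x = y" using * by simp
qed

lemma bmul_bstar_eq:
  assumes "w \<subseteq> arrows G" "inj_on (gd G) w"
  shows "bmul G w (bstar G w) = gr G ` w"
proof (intro set_eqI iffI)
  fix x assume "x \<in> bmul G w (bstar G w)"
  then obtain \<gamma> \<delta> where *: "\<gamma> \<in> w" "\<delta> \<in> w" "gd G \<gamma> = gr G (ginv G \<delta>)" "x = gmul G \<gamma> (ginv G \<delta>)"
    unfolding bmul_def bstar_def by blast
  then have arr: "\<gamma> \<in> arrows G" "\<delta> \<in> arrows G" using assms(1) by auto
  then have "gd G \<gamma> = gd G \<delta>" using * by simp
  then have "\<gamma> = \<delta>" by (rule inj_onD[OF assms(2) _ *(1) *(2)])
  then show "x \<in> gr G ` w" using * arr by auto
next
  fix x assume "x \<in> gr G ` w"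
  then obtain \<gamma> where \<gamma>: "\<gamma> \<in> w" "x = gr G \<gamma>" by blast
  then have "\<gamma> \<in> arrows G" using assms(1) by blast
  then have "x = gmul G \<gamma> (ginv G \<gamma>)" "gd G \<gamma> = gr G (ginv G \<gamma>)" using \<gamma> by simp_all
  then show "x \<in> bmul G w (bstar G w)" using \<gamma>(1) unfolding bmul_def bstar_def by blast
qed

lemma inj_on_gd_bstar:
  assumes "w \<subseteq> arrows G" "inj_on (gr G) w"
  shows "inj_on (gd G) (bstar G w)"
proof (rule inj_onI)
  fix x y assume "x \<in> bstar G w" "y \<in> bstar G w" "gd G x = gd G y"
  then obtain \<gamma> \<delta> where *: "\<gamma> \<in> w" "\<delta> \<in> w" "x = ginv G \<gamma>" "y = ginv G \<delta>" "gd G x = gd G y"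
    unfolding bstar_def by blast
  then have "gr G \<gamma> = gr G \<delta>" using assms(1) by (simp add: subset_iff)
  then have "\<gamma> = \<delta>" by (rule inj_onD[OF assms(2) _ *(1) *(2)])
  then show "x = y" using * by simp
qed

end

section \<open>The cocycle of a choice of sections\<close>

locale etale_twist =
  fixes T :: "('g, 's) twist_data"
  assumes twisted: "twisted_etale_groupoid T"
begin

sublocale et: etale "base T"
  using twisted by (simp add: twisted_etale_groupoid_def etale_def)

sublocale twist T
  using twisted et.topological by (simp add: twisted_etale_groupoid_def twist_def)

lemma twist_bisections_iff:
  "s \<in> twist_bisections T \<longleftrightarrow> bisection G s \<and> (\<exists>\<sigma>. circle_section s \<sigma>)"
  using trivial_iff_circle_section(2)[OF bisection_simps(1)] unfolding twist_bisections_def by blast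

lemma twist_bisections_subset:
  assumes "s \<in> twist_bisections T" "openin (gtop G) V" "V \<subseteq> s"
  shows "V \<in> twist_bisections T"
  using assms bisection_subset circle_section_subset unfolding twist_bisections_iff by metis

lemma twist_bisections_units:
  assumes "openin (gtop G) e" "e \<subseteq> units G"
  shows "e \<in> twist_bisections T"
proof -
  have "continuous_map (subtopology (gtop G) e) (unit_space G) (\<lambda>x. x)"
    using assms(2) continuous_map_from_subtopology[OF continuous_map_id, of "gtop G" e]
    by (auto simp: unit_space_def continuous_map_in_subtopology id_def)
  then have "continuous_map (subtopology (gtop G) e) (gtop H) (\<lambda>x. incl T (1, x))"
    by (intro continuous_map_incl) auto
  then have "circle_section e (\<lambda>x. incl T (1, x))"
    using assms(2) by (auto simp: circle_section_def)
  then show ?thesis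
    using et.bisection_units[OF assms] unfolding twist_bisections_iff by blast
qed

lemma idempotents_iff:
  "e \<in> idempotents G (twist_bisections T) \<longleftrightarrow> openin (gtop G) e \<and> e \<subseteq> units G"
proof
  assume "e \<in> idempotents G (twist_bisections T)"
  then have "bisection G e" "bmul G e e = e"
    by (auto simp: idempotents_def twist_bisections_iff)
  then show "openin (gtop G) e \<and> e \<subseteq> units G"
    using et.idempotent_bisection_subset_units bisection_simps(1) by blast
next
  assume e: "openin (gtop G) e \<and> e \<subseteq> units G"
  then have "e \<subseteq> arrows G" using et.units_subset by blast
  then have "bmul G e e = {\<gamma> \<in> e. gr G \<gamma> \<in> e}"
    using e by (intro et.bmul_units_left) auto
  also have "\<dots> = e" using e by auto
  finally show "e \<in> idempotents G (twist_bisections T)"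
    using e twist_bisections_units by (auto simp: idempotents_def)
qed

text \<open>Shrink a trivializing neighbourhood until both \<open>d\<close> and \<open>r\<close> are homeomorphisms on it.\<close>

lemma twist_bisections_cover:
  assumes "\<gamma> \<in> arrows G"
  obtains s where "s \<in> twist_bisections T" "\<gamma> \<in> s"
proof -
  have top: "\<gamma> \<in> topspace (gtop G)" using assms by (simp add: arrows_def)
  obtain U where U: "openin (gtop G) U" "\<gamma> \<in> U" "circle_bundle_trivial_over T U"
    using locally_trivial[OF assms] by blast
  obtain V where V: "openin (gtop G) V" "\<gamma> \<in> V"
    "homeomorphic_map (subtopology (gtop G) V) (subtopology (unit_space G) (gd G ` V)) (gd G)"
    using top et.gd_local_homeomorphism unfolding local_homeomorphism_def by blast
  obtain W where W: "openin (gtop G) W" "\<gamma> \<in> W"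
    "homeomorphic_map (subtopology (gtop G) W) (subtopology (unit_space G) (gr G ` W)) (gr G)"
    using top et.gr_local_homeomorphism unfolding local_homeomorphism_def by blast
  let ?s = "U \<inter> V \<inter> W"
  have "bisection G ?s"
    unfolding bisection_def
  proof (intro conjI)
    show "openin (gtop G) ?s" using U(1) V(1) W(1) by blast
    show "homeomorphic_map (subtopology (gtop G) ?s) (subtopology (unit_space G) (gd G ` ?s)) (gd G)"
      by (rule homeomorphic_map_restrict[OF V(3) openin_subset[OF V(1)]]) blast
    show "homeomorphic_map (subtopology (gtop G) ?s) (subtopology (unit_space G) (gr G ` ?s)) (gr G)"
      by (rule homeomorphic_map_restrict[OF W(3) openin_subset[OF W(1)]]) blast
  qed
  moreover obtain \<sigma> where "circle_section U \<sigma>"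
    using trivial_iff_circle_section(1)[OF U(1)] U(3) by blast
  then have "circle_section ?s \<sigma>" by (rule circle_section_subset) blast
  ultimately have "?s \<in> twist_bisections T" unfolding twist_bisections_iff by blast
  then show thesis using that U V W by blast
qed

text \<open>A factorization \<open>\<gamma> = \<alpha>\<beta>\<close> with \<open>\<alpha> \<in> s\<close> and \<open>\<beta> \<in> t\<close> is unique: \<open>r(\<gamma>) = r(\<alpha>)\<close> determines
  \<open>\<alpha>\<close> and \<open>d(\<gamma>) = d(\<beta>)\<close> determines \<open>\<beta>\<close>.\<close>

lemma sec_mul_eq:
  assumes s: "s \<subseteq> arrows G" "inj_on (gr G) s" and t: "t \<subseteq> arrows G" "inj_on (gd G) t"
    and \<alpha>\<beta>: "\<alpha> \<in> s" "\<beta> \<in> t" "gd G \<alpha> = gr G \<beta>"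
  shows "sec_mul T s \<xi> t \<eta> (gmul G \<alpha> \<beta>) = lb_mul T (\<xi> \<alpha>) (\<eta> \<beta>)"
  unfolding sec_mul_def
proof (rule the_equality)
  show "\<exists>\<alpha>'\<in>s. \<exists>\<beta>'\<in>t. gd G \<alpha>' = gr G \<beta>' \<and> gmul G \<alpha> \<beta> = gmul G \<alpha>' \<beta>' \<and>
      lb_mul T (\<xi> \<alpha>) (\<eta> \<beta>) = lb_mul T (\<xi> \<alpha>') (\<eta> \<beta>')"
    using \<alpha>\<beta> by blast
  fix a assume "\<exists>\<alpha>'\<in>s. \<exists>\<beta>'\<in>t. gd G \<alpha>' = gr G \<beta>' \<and> gmul G \<alpha> \<beta> = gmul G \<alpha>' \<beta>' \<and>
      a = lb_mul T (\<xi> \<alpha>') (\<eta> \<beta>')"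
  then obtain \<alpha>' \<beta>' where *: "\<alpha>' \<in> s" "\<beta>' \<in> t" "gd G \<alpha>' = gr G \<beta>'"
    "gmul G \<alpha> \<beta> = gmul G \<alpha>' \<beta>'" "a = lb_mul T (\<xi> \<alpha>') (\<eta> \<beta>')"
    by blast
  have arr: "\<alpha> \<in> arrows G" "\<beta> \<in> arrows G" "\<alpha>' \<in> arrows G" "\<beta>' \<in> arrows G"
    using * \<alpha>\<beta> s(1) t(1) by auto
  have "gr G \<alpha> = gr G \<alpha>'" "gd G \<beta> = gd G \<beta>'"
    using *(4) et.mul_simps[OF arr(1,2) \<alpha>\<beta>(3)] et.mul_simps[OF arr(3,4) *(3)] by metis+
  then have "\<alpha> = \<alpha>'" "\<beta> = \<beta>'"
    using inj_onD[OF s(2) _ \<alpha>\<beta>(1) *(1)] inj_onD[OF t(2) _ \<alpha>\<beta>(2) *(2)] by simp_all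
  then show "a = lb_mul T (\<xi> \<alpha>) (\<eta> \<beta>)" using * by simp
qed

lemma cocycle_domain:
  assumes "s \<in> twist_bisections T" "t \<in> twist_bisections T"
  shows "bmul G (bmul G s t) (bstar G (bmul G s t))
    = {gr G \<alpha> |\<alpha> \<beta>. \<alpha> \<in> s \<and> \<beta> \<in> t \<and> gd G \<alpha> = gr G \<beta>}"
proof -
  note s = bisection_simps[of G s] and t = bisection_simps[of G t]
  have b: "bisection G s" "bisection G t" using assms by (auto simp: twist_bisections_iff)
  have "bmul G (bmul G s t) (bstar G (bmul G s t)) = gr G ` bmul G s t"
    using s t b by (intro et.bmul_bstar_eq et.bmul_subset et.inj_on_gd_bmul) auto
  also have "\<dots> = {gr G (gmul G \<alpha> \<beta>) |\<alpha> \<beta>. \<alpha> \<in> s \<and> \<beta> \<in> t \<and> gd G \<alpha> = gr G \<beta>}"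
    unfolding bmul_def by blast
  also have "\<dots> = {gr G \<alpha> |\<alpha> \<beta>. \<alpha> \<in> s \<and> \<beta> \<in> t \<and> gd G \<alpha> = gr G \<beta>}"
  proof -
    have "gr G (gmul G \<alpha> \<beta>) = gr G \<alpha>" if "\<alpha> \<in> s" "\<beta> \<in> t" "gd G \<alpha> = gr G \<beta>" for \<alpha> \<beta>
      using that s(2)[OF b(1)] t(2)[OF b(2)] by (simp add: subset_iff)
    then show ?thesis by (metis (no_types, lifting))
  qed
  finally show ?thesis .
qed

lemma section_fun_unit:
  assumes "x \<in> units G" "\<xi> x = lb_class T (incl T (1, x)) c"
  shows "section_fun T \<xi> x = c"
  unfolding section_fun_def
  using assms lb_class_inject[of "incl T (1, x)"] by (intro the_equality) auto

text \<open>Writing unitary values as \<open>[\<sigma>, 1]\<close>, the cocycle at \<open>r(\<alpha>)\<close> is the scalar by which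
  \<open>u\<^sub>s(\<alpha>) u\<^sub>t(\<beta>)\<close> differs from \<open>u\<^sub>s\<^sub>t(\<alpha>\<beta>)\<close>.\<close>

lemma cocycle_eq:
  assumes st: "s \<in> twist_bisections T" "t \<in> twist_bisections T"
    and \<alpha>\<beta>: "\<alpha> \<in> s" "\<beta> \<in> t" "gd G \<alpha> = gr G \<beta>"
    and \<sigma>: "\<sigma> \<in> arrows H" "p \<sigma> = \<alpha>" "u s \<alpha> = lb_class T \<sigma> 1"
    and \<tau>: "\<tau> \<in> arrows H" "p \<tau> = \<beta>" "u t \<beta> = lb_class T \<tau> 1"
    and \<rho>: "\<rho> \<in> arrows H" "p \<rho> = gmul G \<alpha> \<beta>" "u (bmul G s t) (gmul G \<alpha> \<beta>) = lb_class T \<rho> 1"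
    and z: "cmod z = 1" "gmul H \<sigma> \<tau> = tact T z \<rho>"
  shows "ta_cocycle (assoc_twisted_action T u) s t (gr G \<alpha>) = z"
proof -
  let ?w = "bmul G s t" and ?\<gamma> = "gmul G \<alpha> \<beta>"
  have b: "bisection G s" "bisection G t" using st by (auto simp: twist_bisections_iff)
  note s = bisection_simps[OF b(1)] and t = bisection_simps[OF b(2)]
  have arr: "\<alpha> \<in> arrows G" "\<beta> \<in> arrows G" "?\<gamma> \<in> arrows G"
    using \<alpha>\<beta> s(2) t(2) by (auto intro!: et.mul_simps(1))
  have \<gamma>: "?\<gamma> \<in> ?w" "gr G ?\<gamma> = gr G \<alpha>" "ginv G ?\<gamma> \<in> bstar G ?w"
    using \<alpha>\<beta> arr unfolding bmul_def bstar_def by auto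
  have w: "?w \<subseteq> arrows G" "inj_on (gr G) ?w"
    by (rule et.bmul_subset[OF s(2) t(2)], rule et.inj_on_gr_bmul[OF s(2) t(2) s(4) t(4)])
  have w': "bstar G ?w \<subseteq> arrows G" "inj_on (gd G) (bstar G ?w)"
    using w(1) et.inj_on_gd_bstar[OF w] by (auto simp: bstar_def)
  have x: "gr G \<alpha> = gmul G ?\<gamma> (ginv G ?\<gamma>)" using arr(3) \<gamma>(2) by simp
  have "sec_mul T ?w (sec_mul T s (u s) t (u t)) (bstar G ?w) (sec_star T (u ?w)) (gr G \<alpha>)
      = lb_mul T (sec_mul T s (u s) t (u t) ?\<gamma>) (sec_star T (u ?w) (ginv G ?\<gamma>))"
    unfolding x using arr(3) by (intro sec_mul_eq w w' \<gamma>) simp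
  also have "sec_mul T s (u s) t (u t) ?\<gamma> = lb_class T (gmul H \<sigma> \<tau>) (1 * 1)"
    using sec_mul_eq[OF s(2,4) t(2,3) \<alpha>\<beta>] \<sigma> \<tau> \<alpha>\<beta>(3) by (simp add: lb_mul_class)
  also have "\<dots> = lb_class T \<rho> z"
    using z \<rho>(1) by (simp add: lb_class_tact)
  also have "sec_star T (u ?w) (ginv G ?\<gamma>) = lb_class T (ginv H \<rho>) 1"
    using arr(3) \<rho> by (simp add: sec_star_def lb_star_class)
  also have "lb_mul T (lb_class T \<rho> z) (lb_class T (ginv H \<rho>) 1) = lb_class T (incl T (1, gr G \<alpha>)) z"
    using \<rho> arr \<gamma>(2) by (simp add: lb_mul_class)
  finally have "section_fun T
      (sec_mul T ?w (sec_mul T s (u s) t (u t)) (bstar G ?w) (sec_star T (u ?w))) (gr G \<alpha>) = z"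
    by (intro section_fun_unit) (use arr in auto)
  moreover have "gr G \<alpha> \<in> bmul G ?w (bstar G ?w)"
    unfolding cocycle_domain[OF st] using \<alpha>\<beta> by blast
  ultimately show ?thesis
    by (simp add: assoc_twisted_action_def Let_def)
qed

section \<open>Sieben's condition\<close>

lemma assoc_twisted_action_index [simp]: "ta_index (assoc_twisted_action T u) = twist_bisections T"
  by (simp add: assoc_twisted_action_def Let_def)

lemma section_choice_representative:
  assumes "section_choice T u" "s \<in> twist_bisections T" "\<gamma> \<in> s"
  obtains \<sigma> where "\<sigma> \<in> arrows H" "p \<sigma> = \<gamma>" "u s \<gamma> = lb_class T \<sigma> 1"
proof -
  have s: "s \<subseteq> arrows G" using assms(2) bisection_simps(2) by (auto simp: twist_bisections_iff)
  have c: "continuous_map (subtopology (gtop G) s) (lb_top T) (u s)"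
    and u: "lb_proj T (u s \<gamma>) = \<gamma>" "lb_norm (u s \<gamma>) = 1"
    using assms by (auto simp: section_choice_def continuous_section_def unitary_section_def)
  have "u s \<gamma> \<in> lb_carrier T"
    using continuous_map_funspace[OF c] assms(3) s by (auto simp: topspace_lb_top arrows_def)
  then show thesis using lb_unit_class[OF _ u(2)] u(1) that by metis
qed

text \<open>Apply Sieben's condition to the idempotent \<open>e = r(V)\<close>: here \<open>et = V\<close> by injectivity of \<open>r\<close> on
  \<open>t\<close>, and \<open>u\<^sub>e = 1\<close>, so \<open>\<omega>(e, t)\<close> compares \<open>u\<^sub>t\<close> with \<open>u\<^sub>V\<close>.\<close>

lemma sieben_imp_restriction:
  assumes u: "section_choice T u" and sieben: "sieben_condition G (assoc_twisted_action T u)"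
    and t: "t \<in> twist_bisections T" and V: "openin (gtop G) V" "V \<subseteq> t" and \<gamma>: "\<gamma> \<in> V"
  shows "u t \<gamma> = u V \<gamma>"
proof -
  let ?e = "gr G ` V"
  have VS: "V \<in> twist_bisections T" by (rule twist_bisections_subset[OF t V])
  have bt: "bisection G t" using t by (auto simp: twist_bisections_iff)
  note tt = bisection_simps[OF bt]
  have "openin (unit_space G) ?e"
    using local_homeomorphism_imp_open_map[OF et.gr_local_homeomorphism] V(1)
    unfolding open_map_def by blast
  then have "openin (gtop G) ?e"
    unfolding unit_space_def using et.openin_units by (rule openin_trans_full)
  moreover have e_units: "?e \<subseteq> units G" using V(2) tt(2) by auto
  ultimately have e: "?e \<in> idempotents G (twist_bisections T)"
    unfolding idempotents_iff by blast
  then have eS: "?e \<in> twist_bisections T" by (simp add: idempotents_def)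
  have et: "bmul G ?e t = V"
    unfolding et.bmul_units_left[OF e_units tt(2)]
    using V(2) inj_on_image_mem_iff[OF tt(4) _ V(2)] by blast
  have \<gamma>t: "\<gamma> \<in> t" "\<gamma> \<in> arrows G" "gr G \<gamma> \<in> ?e" using \<gamma> V(2) tt(2) by auto
  obtain \<tau> where \<tau>: "\<tau> \<in> arrows H" "p \<tau> = \<gamma>" "u t \<gamma> = lb_class T \<tau> 1"
    using section_choice_representative[OF u t \<gamma>t(1)] by blast
  obtain \<rho> where \<rho>: "\<rho> \<in> arrows H" "p \<rho> = \<gamma>" "u V \<gamma> = lb_class T \<rho> 1"
    using section_choice_representative[OF u VS \<gamma>] by blast
  obtain z where z: "cmod z = 1" "\<tau> = tact T z \<rho>"
    using quotient_in_kernel[OF \<rho>(1) \<tau>(1)] \<rho>(2) \<tau>(2) by auto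
  let ?\<epsilon> = "incl T (1, gr G \<gamma>)"
  have "ta_cocycle (assoc_twisted_action T u) ?e t (gr G (gr G \<gamma>)) = z"
  proof (rule cocycle_eq[OF eS t \<gamma>t(3,1)])
    show "u ?e (gr G \<gamma>) = lb_class T ?\<epsilon> 1"
      using u e \<gamma>t(3) unfolding section_choice_def fun_section_def by blast
    show "gmul H ?\<epsilon> \<tau> = tact T z \<rho>"
      using E.arrow_simps(7)[OF \<tau>(1)] gr_total[OF \<tau>(1)] \<tau>(2) z(2) by simp
  qed (use \<gamma>t \<tau> \<rho> z et in auto)
  moreover have "ta_cocycle (assoc_twisted_action T u) ?e t
      = multiplier_unit (bmul G (bmul G ?e t) (bstar G (bmul G ?e t)))"
    using sieben eS t e unfolding sieben_condition_def by simp
  moreover have "gr G (gr G \<gamma>) \<in> bmul G (bmul G ?e t) (bstar G (bmul G ?e t))"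
    unfolding cocycle_domain[OF eS t]
    by (intro CollectI exI[of _ "gr G \<gamma>"] exI[of _ \<gamma>]) (use \<gamma>t in auto)
  ultimately have "z = 1" by (simp add: multiplier_unit_def)
  then show ?thesis using \<tau>(3) \<rho>(3) \<rho>(1) z by simp
qed

text \<open>On \<open>s \<inter> t\<close> both \<open>u\<^sub>s\<close> and \<open>u\<^sub>t\<close> agree with \<open>u\<^bsub>s \<inter> t\<^esub>\<close>, so the unitary sections \<open>u\<^sub>s\<close>, viewed as
  sections of \<open>\<Sigma>\<close>, are compatible and can be pasted.\<close>

lemma sieben_imp_circle_section:
  assumes u: "section_choice T u" and sieben: "sieben_condition G (assoc_twisted_action T u)"
  obtains \<sigma> where "circle_section (arrows G) \<sigma>"
proof -
  define S where "S = twist_bisections T"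
  have S: "openin (gtop G) s" "s \<subseteq> arrows G" if "s \<in> S" for s
    using that bisection_simps unfolding S_def twist_bisections_iff by blast+
  have sec: "circle_section s (\<lambda>\<gamma>. direction (u s \<gamma>))" if "s \<in> S" for s
    using u that S(2)[OF that] unfolding section_choice_def S_def unitary_section_def
    by (intro circle_section_direction) auto
  define s0 where "s0 \<gamma> = (SOME s. s \<in> S \<and> \<gamma> \<in> s)" for \<gamma>
  have s0: "s0 \<gamma> \<in> S" "\<gamma> \<in> s0 \<gamma>" if "\<gamma> \<in> arrows G" for \<gamma>
  proof -
    have "\<exists>s. s \<in> S \<and> \<gamma> \<in> s" using twist_bisections_cover[OF that] unfolding S_def by blast
    then show "s0 \<gamma> \<in> S" "\<gamma> \<in> s0 \<gamma>" unfolding s0_def by (metis (mono_tags, lifting) someI_ex)+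
  qed
  have "continuous_map (gtop G) (gtop H) (\<lambda>\<gamma>. direction (u (s0 \<gamma>) \<gamma>))"
  proof (rule pasting_lemma[where I = S and T = "\<lambda>s. s" and f = "\<lambda>s \<gamma>. direction (u s \<gamma>)"])
    show "openin (gtop G) s" if "s \<in> S" for s using S(1)[OF that] .
    show "continuous_map (subtopology (gtop G) s) (gtop H) (\<lambda>\<gamma>. direction (u s \<gamma>))" if "s \<in> S" for s
      using sec[OF that] by (simp add: circle_section_def)
    show "direction (u s \<gamma>) = direction (u t \<gamma>)"
      if "s \<in> S" "t \<in> S" "\<gamma> \<in> topspace (gtop G) \<inter> s \<inter> t" for s t \<gamma>
    proof -
      have "openin (gtop G) (s \<inter> t)" using that S(1) by blast
      then have "u s \<gamma> = u (s \<inter> t) \<gamma>" "u t \<gamma> = u (s \<inter> t) \<gamma>"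
        using that sieben_imp_restriction[OF u sieben, of _ "s \<inter> t" \<gamma>] unfolding S_def by auto
      then show ?thesis by simp
    qed
    show "\<exists>s. s \<in> S \<and> \<gamma> \<in> s \<and> direction (u (s0 \<gamma>) \<gamma>) = direction (u s \<gamma>)"
      if "\<gamma> \<in> topspace (gtop G)" for \<gamma>
      using s0[of \<gamma>] that by (auto simp: arrows_def)
  qed
  moreover have "p (direction (u (s0 \<gamma>) \<gamma>)) = \<gamma>" if "\<gamma> \<in> arrows G" for \<gamma>
    using sec[OF s0(1)[OF that]] s0(2)[OF that] by (simp add: circle_section_def)
  ultimately have "circle_section (arrows G) (\<lambda>\<gamma>. direction (u (s0 \<gamma>) \<gamma>))"
    by (simp add: circle_section_def arrows_def)
  then show thesis by (rule that)
qed

text \<open>Multiplying \<open>\<sigma>(\<gamma>)\<close> by the inverse of \<open>\<sigma>(r(\<gamma>))\<close> changes it only by a scalar, and for a unit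
  \<open>\<gamma>\<close> the two factors cancel.\<close>

lemma normalized_circle_section:
  assumes "circle_section (arrows G) \<sigma>"
  obtains \<sigma>' where "circle_section (arrows G) \<sigma>'" "\<And>x. x \<in> units G \<Longrightarrow> \<sigma>' x = incl T (1, x)"
proof
  let ?\<sigma>' = "\<lambda>\<gamma>. gmul H (ginv H (\<sigma> (gr G \<gamma>))) (\<sigma> \<gamma>)"
  note s = circle_section_simps[OF assms order_refl]
  have \<sigma>: "continuous_map (gtop G) (gtop H) \<sigma>"
    using assms by (simp add: circle_section_def arrows_def)
  have "continuous_map (gtop G) (gtop G) (gr G)"
    using continuous_map_gr[OF base_topological continuous_map_id]
    by (simp add: unit_space_def continuous_map_in_subtopology)
  from continuous_map_compose[OF this \<sigma>]
  have "continuous_map (gtop G) (gtop H) (\<lambda>\<gamma>. \<sigma> (gr G \<gamma>))"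
    by (simp add: o_def)
  then have "continuous_map (gtop G) (gtop H) ?\<sigma>'"
    using s by (intro continuous_map_gmul[OF total_topological continuous_map_ginv[OF total_topological]] \<sigma>)
      (auto simp: arrows_def[symmetric])
  moreover have "p (?\<sigma>' \<gamma>) = \<gamma>" if "\<gamma> \<in> arrows G" for \<gamma>
    using s that by simp
  ultimately show "circle_section (arrows G) ?\<sigma>'"
    by (simp add: circle_section_def arrows_def)
  show "?\<sigma>' x = incl T (1, x)" if "x \<in> units G" for x
    using s[of x] that by simp
qed

text \<open>Restrict one normalized global section to all bisections. If \<open>\<alpha>\<close> or \<open>\<beta>\<close> is a unit, then
  \<open>\<sigma>(\<alpha>)\<sigma>(\<beta>) = \<sigma>(\<alpha>\<beta>)\<close>, because the unit is sent to a unit.\<close>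

lemma circle_section_imp_sieben:
  assumes "circle_section (arrows G) \<sigma>"
  shows "\<exists>u. section_choice T u \<and> sieben_condition G (assoc_twisted_action T u)"
proof -
  obtain \<sigma> where \<sigma>: "circle_section (arrows G) \<sigma>"
    and \<sigma>_unit: "\<And>x. x \<in> units G \<Longrightarrow> \<sigma> x = incl T (1, x)"
    using normalized_circle_section[OF assms] by blast
  note s = circle_section_simps[OF \<sigma> order_refl]
  define u :: "'g set \<Rightarrow> 'g \<Rightarrow> 's lb" where "u = (\<lambda>_ \<gamma>. lb_class T (\<sigma> \<gamma>) 1)"
  have SG: "t \<subseteq> arrows G" if "t \<in> twist_bisections T" for t
    using that bisection_simps(2) by (auto simp: twist_bisections_iff)
  have "section_choice T u"
    unfolding section_choice_def continuous_section_def unitary_section_def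
  proof (intro conjI ballI)
    fix t assume t: "t \<in> twist_bisections T"
    show "continuous_map (subtopology (gtop G) t) (lb_top T) (u t)"
      unfolding u_def using circle_section_subset[OF \<sigma> SG[OF t]]
      by (intro continuous_map_lb_class) (auto simp: circle_section_def)
    show "lb_proj T (u t \<gamma>) = \<gamma>" "lb_norm (u t \<gamma>) = 1" if "\<gamma> \<in> t" for \<gamma>
      using s[of \<gamma>] that SG[OF t] by (auto simp: u_def)
  next
    fix e x assume "e \<in> idempotents G (twist_bisections T)" "x \<in> e"
    then have "x \<in> units G" unfolding idempotents_iff by blast
    then show "u e x = fun_section T (\<lambda>_. 1) x"
      by (simp add: u_def fun_section_def \<sigma>_unit)
  qed
  moreover have "sieben_condition G (assoc_twisted_action T u)"
    unfolding sieben_condition_def assoc_twisted_action_index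
  proof (intro ballI impI)
    fix s' t assume S: "s' \<in> twist_bisections T" "t \<in> twist_bisections T"
      and "s' \<in> idempotents G (twist_bisections T) \<or> t \<in> idempotents G (twist_bisections T)"
    then have unit: "s' \<subseteq> units G \<or> t \<subseteq> units G" by (auto simp: idempotents_iff)
    let ?D = "bmul G (bmul G s' t) (bstar G (bmul G s' t))"
    show "ta_cocycle (assoc_twisted_action T u) s' t = multiplier_unit ?D"
    proof
      fix x
      show "ta_cocycle (assoc_twisted_action T u) s' t x = multiplier_unit ?D x"
      proof (cases "x \<in> ?D")
        case True
        then obtain \<alpha> \<beta> where *: "\<alpha> \<in> s'" "\<beta> \<in> t" "gd G \<alpha> = gr G \<beta>" "x = gr G \<alpha>"
          unfolding cocycle_domain[OF S] by blast
        have arr: "\<alpha> \<in> arrows G" "\<beta> \<in> arrows G" "gmul G \<alpha> \<beta> \<in> arrows G"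
          using * SG[OF S(1)] SG[OF S(2)] by (auto intro!: et.mul_simps(1))
        have "gmul H (\<sigma> \<alpha>) (\<sigma> \<beta>) = \<sigma> (gmul G \<alpha> \<beta>)"
        proof (cases "\<alpha> \<in> units G")
          case True
          then have "\<alpha> = gr G \<beta>" using *(3) by simp
          then show ?thesis
            using \<sigma>_unit[OF True] s[OF arr(2)] arr(2) E.arrow_simps(7)[OF s(1)[OF arr(2)]]
            by (simp add: gr_total[OF s(1)[OF arr(2)]])
        next
          case False
          then have "\<beta> \<in> units G" using unit * by blast
          then have "\<beta> = gd G \<alpha>" using *(3) by simp
          then show ?thesis
            using \<sigma>_unit[OF \<open>\<beta> \<in> units G\<close>] s[OF arr(1)] arr(1) E.arrow_simps(8)[OF s(1)[OF arr(1)]]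
            by (simp add: gd_total[OF s(1)[OF arr(1)]])
        qed
        then have "ta_cocycle (assoc_twisted_action T u) s' t (gr G \<alpha>) = 1"
          using s arr by (intro cocycle_eq[OF S *(1-3), of "\<sigma> \<alpha>" _ "\<sigma> \<beta>" "\<sigma> (gmul G \<alpha> \<beta>)"])
            (auto simp: u_def)
        then show ?thesis using True * by (simp add: multiplier_unit_def)
      next
        case False
        then show ?thesis
          by (simp add: assoc_twisted_action_def Let_def multiplier_unit_def)
      qed
    qed
  qed
  ultimately show ?thesis by blast
qed

end

theorem proposition7p4:
  fixes T :: "('g, 's) twist_data"
  assumes "twisted_etale_groupoid T"
  shows "((\<exists>u. section_choice T u \<and> sieben_condition (base T) (assoc_twisted_action T u))
           \<longleftrightarrow> twist_topologically_trivial T)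
       \<and> (twist_topologically_trivial T \<longleftrightarrow> line_bundle_topologically_trivial T)"
proof -
  interpret etale_twist T by (rule etale_twist.intro[OF assms])
  have "openin (gtop G) (arrows G)" by (simp add: arrows_def)
  note trivial = trivial_iff_circle_section[OF this]
  show ?thesis
    unfolding twist_topologically_trivial_def line_bundle_topologically_trivial_def trivial
    using sieben_imp_circle_section circle_section_imp_sieben by blast
qed

end
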